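(* The decision problem HD is $\exists\mathbb{R}$-hard.
   Context: Polynomials are given as explicit sums of monomials with integer coefficients written in binary; rational numbers are given as fractions of integers. The complexity class $\exists\mathbb{R}$ consists of all decision problems that are polynomial-time many-one reducible to the existential theory of the reals, i.e. the set of true sentences $\exists x_1\dots\exists x_n\,\Phi(x_1,\dots,x_n)$ where $\Phi$ is a quantifier-free Boolean combination of polynomial equations and inequalities with integer coefficients. A problem is $\exists\mathbb{R}$-hard if the existential theory of the reals (equivalently, the problem FEAS: given $r\in\mathbb{Z}[y_1,\dots,y_m]$, does $r$ have a real zero?) polynomial-time many-one reduces to it. HD (Hole Detection): Instance: a polynomial $f\in\mathbb{Z}[x_1,\dots,x_d]$ and a rational threshold $\theta>0$. Question: is the first singular homology group with integer coefficients $H_1(L_\theta;\mathbb{Z})$ of the super-level set $L_\theta=\{x\in\mathbb{R}^d: f(x)\ge\theta\}$ non-trivial? *)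

theory Defs
  imports "HOL-Homology.Homology" "HOL-Computational_Algebra.Polynomial"
begin

section \<open>Deterministic multi-tape Turing machines and polynomial-time reductions\<close>

text \<open>States and tape symbols are natural numbers below the bounds \<open>nstates\<close> and
  \<open>nsymbols\<close>. Symbol 0 is the blank, 1 and 2 are the bits \<open>False\<close> and \<open>True\<close>,
  further symbols are work symbols. Tapes are infinite in both directions.\<close>

datatype move = Left | Stay | Right

record tm =
  ntapes :: nat
  nsymbols :: nat
  nstates :: nat
  init_state :: nat
  halt_state :: nat
  delta :: "nat \<Rightarrow> nat list \<Rightarrow> nat \<times> (nat \<times> move) list"

definition wf_tm :: "tm \<Rightarrow> bool" where
  "wf_tm M \<longleftrightarrow> ntapes M \<ge> 1 \<and> nsymbols M \<ge> 3 \<and>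
     init_state M < nstates M \<and> halt_state M < nstates M \<and>
     (\<forall>q < nstates M. \<forall>a. length a = ntapes M \<and> set a \<subseteq> {..<nsymbols M} \<longrightarrow>
        fst (delta M q a) < nstates M \<and>
        length (snd (delta M q a)) = ntapes M \<and>
        fst ` set (snd (delta M q a)) \<subseteq> {..<nsymbols M})"

text \<open>A tape is its content together with the head position.\<close>

type_synonym tape = "(int \<Rightarrow> nat) \<times> int"
type_synonym config = "nat \<times> tape list"

fun shift :: "move \<Rightarrow> int \<Rightarrow> int" where
  "shift Left i = i - 1"
| "shift Stay i = i"
| "shift Right i = i + 1"

definition read_tape :: "tape \<Rightarrow> nat" where
  "read_tape t = fst t (snd t)"

definition act_tape :: "nat \<times> move \<Rightarrow> tape \<Rightarrow> tape" where
  "act_tape a t = ((fst t)(snd t := fst a), shift (snd a) (snd t))"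

definition tm_step :: "tm \<Rightarrow> config \<Rightarrow> config" where
  "tm_step M c =
     (if fst c = halt_state M then c
      else let r = delta M (fst c) (map read_tape (snd c))
           in (fst r, map2 act_tape (snd r) (snd c)))"

text \<open>The bit string \<open>w\<close> occupies the cells \<open>0, \<dots>, length w - 1\<close>; all other cells are blank.\<close>

definition tape_content :: "bool list \<Rightarrow> int \<Rightarrow> nat" where
  "tape_content w i =
     (if 0 \<le> i \<and> i < int (length w) then if w ! nat i then 2 else 1 else 0)"

definition init_config :: "tm \<Rightarrow> bool list \<Rightarrow> config" where
  "init_config M w =
     (init_state M, (tape_content w, 0) # replicate (ntapes M - 1) (tape_content [], 0))"

text \<open>The input is on the first tape and the output on the last one; the final position of the
  heads and the final content of the other tapes are irrelevant.\<close>

definition polytime_computable :: "(bool list \<Rightarrow> bool list) \<Rightarrow> bool" where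
  "polytime_computable g \<longleftrightarrow>
     (\<exists>M. \<exists>p :: nat poly. wf_tm M \<and>
        (\<forall>w. \<exists>t \<le> poly p (length w).
           let c = (tm_step M ^^ t) (init_config M w)
           in fst c = halt_state M \<and> fst (last (snd c)) = tape_content (g w)))"

type_synonym problem = "bool list set"

definition polytime_reducible :: "problem \<Rightarrow> problem \<Rightarrow> bool"  (infix "\<le>\<^sub>p" 50) where
  "A \<le>\<^sub>p B \<longleftrightarrow> (\<exists>g. polytime_computable g \<and> (\<forall>w. w \<in> A \<longleftrightarrow> g w \<in> B))"


section \<open>Polynomials with integer coefficients\<close>

text \<open>A polynomial in \<open>n\<close> variables is an explicit sum of terms \<open>(c, e)\<close>, standing for
  \<open>c * x\<^sub>0 ^ (e ! 0) * \<dots> * x\<^sub>n\<^sub>-\<^sub>1 ^ (e ! (n - 1))\<close>. The empty list is the zero polynomial;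
  a monomial may occur in several terms.\<close>

type_synonym int_poly = "(int \<times> nat list) list"

definition is_poly :: "nat \<Rightarrow> int_poly \<Rightarrow> bool" where
  "is_poly n p \<longleftrightarrow> (\<forall>(c, e) \<in> set p. length e = n)"

definition eval_poly :: "int_poly \<Rightarrow> (nat \<Rightarrow> real) \<Rightarrow> real" where
  "eval_poly p x = (\<Sum>(c, e) \<leftarrow> p. of_int c * (\<Prod>i<length e. x i ^ (e ! i)))"


section \<open>Encodings as bit strings\<close>

text \<open>All encodings are self-delimiting, so that concatenation encodes tuples. Coefficients are
  written in binary (least significant bit first, after a sign bit). Numbers of variables and
  exponents are written in unary: a monomial takes space proportional to its degree, as if it
  were written out as a product of variables.\<close>

fun binary :: "nat \<Rightarrow> bool list" where
  "binary n = (if n = 0 then [] else odd n # binary (n div 2))"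

declare binary.simps [simp del]

definition enc_list :: "('a \<Rightarrow> bool list) \<Rightarrow> 'a list \<Rightarrow> bool list" where
  "enc_list enc xs = concat (map (\<lambda>x. True # enc x) xs) @ [False]"

definition enc_unary :: "nat \<Rightarrow> bool list" where
  "enc_unary n = replicate n True @ [False]"

definition enc_int :: "int \<Rightarrow> bool list" where
  "enc_int i = (i < 0) # enc_list (\<lambda>b. [b]) (binary (nat \<bar>i\<bar>))"

definition enc_term :: "int \<times> nat list \<Rightarrow> bool list" where
  "enc_term t = enc_int (fst t) @ enc_list enc_unary (snd t)"

definition enc_poly :: "int_poly \<Rightarrow> bool list" where
  "enc_poly p = enc_list enc_term p"


section \<open>The existential theory of the reals\<close>

text \<open>Quantifier-free formulas; the atoms are \<open>p = 0\<close>, \<open>p \<ge> 0\<close> and \<open>p > 0\<close>.\<close>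

datatype qf_formula =
    EqZero int_poly
  | GeZero int_poly
  | GtZero int_poly
  | Neg qf_formula
  | Conj qf_formula qf_formula
  | Disj qf_formula qf_formula

primrec is_formula :: "nat \<Rightarrow> qf_formula \<Rightarrow> bool" where
  "is_formula n (EqZero p) \<longleftrightarrow> is_poly n p"
| "is_formula n (GeZero p) \<longleftrightarrow> is_poly n p"
| "is_formula n (GtZero p) \<longleftrightarrow> is_poly n p"
| "is_formula n (Neg \<phi>) \<longleftrightarrow> is_formula n \<phi>"
| "is_formula n (Conj \<phi> \<psi>) \<longleftrightarrow> is_formula n \<phi> \<and> is_formula n \<psi>"
| "is_formula n (Disj \<phi> \<psi>) \<longleftrightarrow> is_formula n \<phi> \<and> is_formula n \<psi>"

primrec holds :: "qf_formula \<Rightarrow> (nat \<Rightarrow> real) \<Rightarrow> bool" where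
  "holds (EqZero p) x \<longleftrightarrow> eval_poly p x = 0"
| "holds (GeZero p) x \<longleftrightarrow> eval_poly p x \<ge> 0"
| "holds (GtZero p) x \<longleftrightarrow> eval_poly p x > 0"
| "holds (Neg \<phi>) x \<longleftrightarrow> \<not> holds \<phi> x"
| "holds (Conj \<phi> \<psi>) x \<longleftrightarrow> holds \<phi> x \<and> holds \<psi> x"
| "holds (Disj \<phi> \<psi>) x \<longleftrightarrow> holds \<phi> x \<or> holds \<psi> x"

primrec enc_formula :: "qf_formula \<Rightarrow> bool list" where
  "enc_formula (EqZero p) = [False, False, False] @ enc_poly p"
| "enc_formula (GeZero p) = [False, False, True] @ enc_poly p"
| "enc_formula (GtZero p) = [False, True, False] @ enc_poly p"
| "enc_formula (Neg \<phi>) = [False, True, True] @ enc_formula \<phi>"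
| "enc_formula (Conj \<phi> \<psi>) = [True, False, False] @ enc_formula \<phi> @ enc_formula \<psi>"
| "enc_formula (Disj \<phi> \<psi>) = [True, False, True] @ enc_formula \<phi> @ enc_formula \<psi>"

text \<open>The pair \<open>(n, \<phi>)\<close> represents the sentence \<open>\<exists>x\<^sub>0 \<dots> x\<^sub>n\<^sub>-\<^sub>1. \<phi>\<close>; the values \<open>x i\<close> for
  \<open>i \<ge> n\<close> are not used by \<open>\<phi>\<close>.\<close>

definition enc_sentence :: "nat \<Rightarrow> qf_formula \<Rightarrow> bool list" where
  "enc_sentence n \<phi> = enc_unary n @ enc_formula \<phi>"

definition ETR :: problem where
  "ETR = {enc_sentence n \<phi> | n \<phi>. is_formula n \<phi> \<and> (\<exists>x. holds \<phi> x)}"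

definition ER_hard :: "problem \<Rightarrow> bool" where
  "ER_hard A \<longleftrightarrow> ETR \<le>\<^sub>p A"


section \<open>Hole detection\<close>

definition superlevel :: "nat \<Rightarrow> int_poly \<Rightarrow> real \<Rightarrow> (nat \<Rightarrow> real) topology" where
  "superlevel d f \<theta> = subtopology (Euclidean_space d) {x. eval_poly f x \<ge> \<theta>}"

definition has_hole :: "nat \<Rightarrow> int_poly \<Rightarrow> real \<Rightarrow> bool" where
  "has_hole d f \<theta> \<longleftrightarrow> \<not> trivial_group (homology_group 1 (superlevel d f \<theta>))"

text \<open>The threshold is the fraction \<open>a / b\<close>.\<close>

definition enc_HD_instance :: "nat \<Rightarrow> int_poly \<Rightarrow> int \<Rightarrow> int \<Rightarrow> bool list" where
  "enc_HD_instance d f a b = enc_unary d @ enc_poly f @ enc_int a @ enc_int b"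

definition HD :: problem where
  "HD = {enc_HD_instance d f a b | d f a b.
           is_poly d f \<and> b \<noteq> 0 \<and> real_of_int a / real_of_int b > 0 \<and>
           has_hole d f (real_of_int a / real_of_int b)}"


section \<open>The encodings are uniquely decodable\<close>

definition prefix_free :: "('a \<Rightarrow> bool list) \<Rightarrow> bool" where
  "prefix_free enc \<longleftrightarrow> (\<forall>x y u v. enc x @ u = enc y @ v \<longrightarrow> x = y \<and> u = v)"

lemma prefix_freeD: "prefix_free enc \<Longrightarrow> enc x @ u = enc y @ v \<Longrightarrow> x = y \<and> u = v"
  unfolding prefix_free_def by blast

lemma enc_list_simps:
  "enc_list enc [] = [False]"
  "enc_list enc (x # xs) = True # enc x @ enc_list enc xs"
  by (simp_all add: enc_list_def)

lemma prefix_free_enc_list: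
  assumes "prefix_free enc"
  shows "prefix_free (enc_list enc)"
proof -
  have "xs = ys \<and> u = v" if "enc_list enc xs @ u = enc_list enc ys @ v" for xs ys u v
    using that
  proof (induction xs arbitrary: ys)
    case Nil
    then show ?case by (cases ys) (auto simp: enc_list_simps)
  next
    case (Cons x xs)
    then obtain y ys' where ys: "ys = y # ys'"
      by (cases ys) (auto simp: enc_list_simps)
    with Cons.prems have "enc x @ (enc_list enc xs @ u) = enc y @ (enc_list enc ys' @ v)"
      by (simp add: enc_list_simps)
    from prefix_freeD[OF assms this] Cons.IH[of ys'] show ?case
      by (simp add: ys)
  qed
  then show ?thesis
    unfolding prefix_free_def by blast
qed

lemma prefix_free_enc_unary: "prefix_free enc_unary"
proof -
  have "m = n \<and> u = v" if "enc_unary m @ u = enc_unary n @ v" for m n u v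
    using that
  proof (induction m arbitrary: n)
    case 0
    then show ?case by (cases n) (auto simp: enc_unary_def)
  next
    case (Suc m)
    then show ?case by (cases n) (auto simp: enc_unary_def)
  qed
  then show ?thesis
    unfolding prefix_free_def by blast
qed

lemma binary_inject: "binary m = binary n \<Longrightarrow> m = n"
proof (induction m arbitrary: n rule: less_induct)
  case (less m)
  show ?case
  proof (cases "m = 0 \<or> n = 0")
    case True
    then show ?thesis
      using less.prems binary.simps[of m] binary.simps[of n] by (auto split: if_splits)
  next
    case False
    then have "odd m = odd n" "binary (m div 2) = binary (n div 2)"
      using less.prems binary.simps[of m] binary.simps[of n] by auto
    moreover from this(2) False less.IH[of "m div 2" "n div 2"] have "m div 2 = n div 2"
      by simp
    ultimately show ?thesis
      by (metis div_mult_mod_eq odd_iff_mod_2_eq_one parity_cases)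
  qed
qed

lemma prefix_free_enc_int: "prefix_free enc_int"
proof -
  have pf: "prefix_free (enc_list (\<lambda>b. [b]))"
    by (rule prefix_free_enc_list) (simp add: prefix_free_def)
  have "i = j \<and> u = v" if "enc_int i @ u = enc_int j @ v" for i j u v
  proof -
    from that have sgn: "i < 0 \<longleftrightarrow> j < 0"
      and "enc_list (\<lambda>b. [b]) (binary (nat \<bar>i\<bar>)) @ u = enc_list (\<lambda>b. [b]) (binary (nat \<bar>j\<bar>)) @ v"
      by (simp_all add: enc_int_def)
    from prefix_freeD[OF pf this(2)] have "nat \<bar>i\<bar> = nat \<bar>j\<bar>" "u = v"
      by (simp_all add: binary_inject)
    with sgn show ?thesis by linarith
  qed
  then show ?thesis
    unfolding prefix_free_def by blast
qed

lemma prefix_free_enc_term: "prefix_free enc_term"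
proof -
  have "s = t \<and> u = v" if "enc_term s @ u = enc_term t @ v" for s t u v
  proof -
    from that have "enc_int (fst s) @ (enc_list enc_unary (snd s) @ u) =
        enc_int (fst t) @ (enc_list enc_unary (snd t) @ v)"
      by (simp add: enc_term_def)
    note 1 = prefix_freeD[OF prefix_free_enc_int this]
    note 2 = prefix_freeD[OF prefix_free_enc_list[OF prefix_free_enc_unary] conjunct2[OF 1]]
    from 1 2 show ?thesis by (simp add: prod_eq_iff)
  qed
  then show ?thesis
    unfolding prefix_free_def by blast
qed

lemma prefix_free_enc_poly: "prefix_free enc_poly"
  using prefix_free_enc_list[OF prefix_free_enc_term]
  unfolding prefix_free_def enc_poly_def .

lemma prefix_free_enc_formula: "prefix_free enc_formula"
proof -
  have "\<phi> = \<psi> \<and> u = v" if "enc_formula \<phi> @ u = enc_formula \<psi> @ v" for \<phi> \<psi> u v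
    using that
  proof (induction \<phi> arbitrary: \<psi> u v)
    case (EqZero p)
    then show ?case by (cases \<psi>) (auto dest: prefix_freeD[OF prefix_free_enc_poly])
  next
    case (GeZero p)
    then show ?case by (cases \<psi>) (auto dest: prefix_freeD[OF prefix_free_enc_poly])
  next
    case (GtZero p)
    then show ?case by (cases \<psi>) (auto dest: prefix_freeD[OF prefix_free_enc_poly])
  next
    case (Neg \<phi>)
    then show ?case by (cases \<psi>) auto
  next
    case (Conj \<phi>1 \<phi>2)
    show ?case
    proof (cases \<psi>)
      case (Conj \<psi>1 \<psi>2)
      with Conj.prems have
        "enc_formula \<phi>1 @ (enc_formula \<phi>2 @ u) = enc_formula \<psi>1 @ (enc_formula \<psi>2 @ v)"
        by simp
      note 1 = Conj.IH(1)[OF this]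
      note 2 = Conj.IH(2)[OF conjunct2[OF 1]]
      from 1 2 Conj show ?thesis by simp
    qed (use Conj.prems in auto)
  next
    case (Disj \<phi>1 \<phi>2)
    show ?case
    proof (cases \<psi>)
      case (Disj \<psi>1 \<psi>2)
      with Disj.prems have
        "enc_formula \<phi>1 @ (enc_formula \<phi>2 @ u) = enc_formula \<psi>1 @ (enc_formula \<psi>2 @ v)"
        by simp
      note 1 = Disj.IH(1)[OF this]
      note 2 = Disj.IH(2)[OF conjunct2[OF 1]]
      from 1 2 Disj show ?thesis by simp
    qed (use Disj.prems in auto)
  qed
  then show ?thesis
    unfolding prefix_free_def by blast
qed

lemma enc_sentence_in_ETR_iff:
  "enc_sentence n \<phi> \<in> ETR \<longleftrightarrow> is_formula n \<phi> \<and> (\<exists>x. holds \<phi> x)"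
proof -
  have inj: "m = n \<and> \<psi> = \<phi>" if "enc_sentence m \<psi> = enc_sentence n \<phi>" for m \<psi>
  proof -
    from that have "enc_unary m @ enc_formula \<psi> = enc_unary n @ enc_formula \<phi>"
      by (simp add: enc_sentence_def)
    note 1 = prefix_freeD[OF prefix_free_enc_unary this]
    then have "enc_formula \<psi> @ [] = enc_formula \<phi> @ []" by simp
    from 1 prefix_freeD[OF prefix_free_enc_formula this] show ?thesis by simp
  qed
  show ?thesis
    unfolding ETR_def by (auto dest!: sym[of "enc_sentence n \<phi>"] inj)
qed

lemma enc_HD_instance_in_HD_iff:
  "enc_HD_instance d f a b \<in> HD \<longleftrightarrow>
     is_poly d f \<and> b \<noteq> 0 \<and> real_of_int a / real_of_int b > 0 \<and>
     has_hole d f (real_of_int a / real_of_int b)"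
proof -
  have inj: "d' = d \<and> f' = f \<and> a' = a \<and> b' = b"
    if "enc_HD_instance d' f' a' b' = enc_HD_instance d f a b" for d' f' a' b'
  proof -
    from that have 1: "d' = d"
      "enc_poly f' @ enc_int a' @ enc_int b' = enc_poly f @ enc_int a @ enc_int b"
      using prefix_freeD[OF prefix_free_enc_unary] unfolding enc_HD_instance_def by blast+
    from 1(2) have 2: "f' = f" "enc_int a' @ enc_int b' = enc_int a @ enc_int b"
      using prefix_freeD[OF prefix_free_enc_poly] by blast+
    from 2(2) have 3: "a' = a" "enc_int b' = enc_int b"
      using prefix_freeD[OF prefix_free_enc_int] by blast+
    from 3(2) have "b' = b"
      using prefix_freeD[OF prefix_free_enc_int, of b' "[]" b "[]"] by simp
    with 1 2 3 show ?thesis by simp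
  qed
  show ?thesis
    unfolding HD_def by (auto dest!: sym[of "enc_HD_instance d f a b"] inj)
qed

end

theory Submission
  imports Defs
begin

text \<open>Let the positions of an input word \<open>w\<close> be its letters together with a left and a right end
  marker. With every pair \<open>(p, q)\<close> of positions we associate a fixed number of real variables, and
  the produced polynomial is \<open>1 - \<Sum>\<^sub>p\<^sub>,\<^sub>q (F\<^sup>2 + (u\<^sup>2 + v\<^sup>2 - 1)\<^sup>2 + (\<kappa> - kind p q)\<^sup>2)\<close> with
  threshold 1, where \<open>F\<close> is one fixed polynomial in the variables of the pairs \<open>(p, p)\<close>, \<open>(q, q)\<close>
  and \<open>(p, q)\<close>. The super-level set is thus the product of a real algebraic set with circles: it is
  empty or retracts onto a circle, so its first homology is non-trivial iff \<open>F\<close> can be annihilated.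

  The polynomial \<open>F\<close> expresses that the variables of the pairs \<open>(p, p)\<close> form a run of a register
  automaton with real registers on \<open>w\<close>, which parses \<open>w\<close> as a sentence of the existential theory of
  the reals and evaluates it. Constraints between all pairs of positions give access by index to the
  values of the quantified variables, which are stored at the positions. All inequalities and
  disjunctions are removed by slack variables. Since \<open>F\<close> does not depend on \<open>w\<close>, the reduction only
  runs nested loops over positions, and all parsing is left to the polynomial.\<close>

section \<open>Homology of the super-level sets\<close>

text \<open>A reduction has to be given as a concrete Turing machine with a bound on its running
  time, and a verified machine that parses nested formulas would dominate the development. This is
  why \<open>F\<close> is universal: a word enters only through the kinds of its pairs of positions,
  which the machine finds by comparing marks. Each kind is forced upon a variable
  \<open>\<kappa>\<close> that \<open>F\<close> reads, so that one \<open>F\<close> serves all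
  pairs. Malformed words need no separate treatment: they admit no run, and the empty space has
  trivial homology. A run may compute in both directions because it is a system of constraints on
  existentially quantified registers, without an order of execution. The constant 1 keeps the
  threshold positive: 1 minus a sum of squares is at least 1 exactly on the common zeros of the
  squared terms. Every pair carries a circle only for uniformity; the homology argument uses the
  circle of the pair \<open>(0, 0)\<close> alone, as a retract, so nothing has to be known about the
  topology of the other factor.\<close>

lemma not_trivial_homology_nsphere: "\<not> trivial_group (homology_group 1 (nsphere 1))"
  using trivial_reduced_homology_group_nsphere[of 1 1] by (simp add: un_reduced_homology_group)

text \<open>A left inverse of \<open>f\<close> induces a left inverse in homology, so the homology
  of \<open>X\<close> embeds into that of \<open>Y\<close>. A trivial target then leaves at most one
  element in the source.\<close>

lemma nontrivial_homology_if_section: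
  assumes "section_map X Y f" and "\<not> trivial_group (homology_group p X)"
  shows "\<not> trivial_group (homology_group p Y)"
proof
  assume triv: "trivial_group (homology_group p Y)"
  let ?h = "hom_induced p X {} Y {} f"
  have inj: "inj_on ?h (carrier (homology_group p X))"
    by (rule inj_on_hom_induced_section_map[OF assms(1)])
  have "?h ` carrier (homology_group p X) \<subseteq> carrier (homology_group p Y)"
    using hom_induced_empty_hom[of p X Y f] unfolding hom_def by auto
  with triv have "\<exists>b. ?h ` carrier (homology_group p X) \<subseteq> {b}"
    by (auto simp: trivial_group_def)
  then obtain b where "?h ` carrier (homology_group p X) \<subseteq> {b}" by blast
  then have "x = y" if "x \<in> carrier (homology_group p X)" "y \<in> carrier (homology_group p X)" for x y
    using inj_onD[OF inj _ that] that by blast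
  then have "\<exists>a. carrier (homology_group p X) \<subseteq> {a}"
    by (metis singletonI subsetI)
  then show False
    using assms(2) group.trivial_group_alt[OF group_relative_homology_group] by metis
qed

lemma no_hole_if_empty:
  assumes "\<And>x. eval_poly f x < \<theta>"
  shows "\<not> has_hole d f \<theta>"
proof -
  have "topspace (superlevel d f \<theta>) = {}"
    using assms by (simp add: superlevel_def flip: not_le)
  then show ?thesis
    by (simp add: has_hole_def trivial_homology_group_empty)
qed

text \<open>The inclusion \<open>s\<close> inserts a circle point into coordinates 0 and 1 of
  \<open>z\<close>, and \<open>r\<close> projects to these coordinates. Since \<open>r\<close>
  undoes \<open>s\<close>, the circle is a retract of the super-level set. The support condition on
  \<open>z\<close> places the image of \<open>s\<close> in the Euclidean space of dimension
  \<open>d\<close>.\<close>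

lemma has_hole_if_circle_factor:
  assumes d: "d \<ge> 2"
    and circle: "\<And>x. eval_poly f x \<ge> \<theta> \<Longrightarrow> (x 0)\<^sup>2 + (x 1)\<^sup>2 = 1"
    and z: "\<And>u v. u\<^sup>2 + v\<^sup>2 = 1 \<Longrightarrow> eval_poly f (z(0 := u, 1 := v)) \<ge> \<theta>"
    and supp: "\<And>i. i \<ge> d \<Longrightarrow> z i = 0"
  shows "has_hole d f \<theta>"
proof -
  let ?L = "superlevel d f \<theta>"
  define s where "s = (\<lambda>c::nat \<Rightarrow> real. z(0 := c 0, 1 := c 1))"
  define r where "r = (\<lambda>x::nat \<Rightarrow> real. (\<lambda>i. if i < 2 then x i else 0))"
  have top1: "topspace (nsphere 1) = {c. (c 0)\<^sup>2 + (c 1)\<^sup>2 = 1 \<and> (\<forall>i>1. c i = 0)}"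
    by (simp add: nsphere)
  have topL: "topspace ?L = {x. (\<forall>i\<ge>d. x i = 0) \<and> eval_poly f x \<ge> \<theta>}"
    by (auto simp: superlevel_def topspace_Euclidean_space)
  have cs: "continuous_map (nsphere 1) ?L s"
    unfolding superlevel_def continuous_map_in_subtopology
  proof
    have "continuous_map (nsphere 1) (powertop_real UNIV) s"
      unfolding continuous_map_componentwise_UNIV
    proof
      fix i
      have "continuous_map (nsphere 1) euclideanreal (\<lambda>c. c k)" for k
        by (rule continuous_map_nsphere_projection)
      then show "continuous_map (nsphere 1) euclideanreal (\<lambda>x. s x i)"
        by (simp add: s_def)
    qed
    moreover have "s c i = 0" if "c \<in> topspace (nsphere 1)" "i \<ge> d" for c i
      using that d supp by (auto simp: s_def)
    ultimately show "continuous_map (nsphere 1) (Euclidean_space d) s"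
      unfolding Euclidean_space_def continuous_map_in_subtopology by auto
    show "s \<in> topspace (nsphere 1) \<rightarrow> {x. \<theta> \<le> eval_poly f x}"
      using z unfolding top1 by (auto simp: s_def)
  qed
  have proj: "continuous_map ?L euclideanreal (\<lambda>x. x k)" for k
    unfolding superlevel_def Euclidean_space_def
    by (intro continuous_map_from_subtopology continuous_map_product_projection) simp
  have cr: "continuous_map ?L (nsphere 1) r"
    unfolding nsphere continuous_map_in_subtopology
  proof
    show "continuous_map ?L (powertop_real UNIV) r"
      unfolding continuous_map_componentwise_UNIV using proj by (simp add: r_def)
    show "r \<in> topspace ?L \<rightarrow> {x. (\<Sum>i\<le>1. (x i)\<^sup>2) = 1 \<and> (\<forall>i>1. x i = 0)}"
      using circle by (auto simp: r_def topL)
  qed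
  have "r (s c) = c" if "c \<in> topspace (nsphere 1)" for c
  proof
    fix i
    show "r (s c) i = c i"
      using that unfolding top1 r_def s_def by (cases "i = 0"; cases "i = 1") auto
  qed
  with cs cr have "section_map (nsphere 1) ?L s"
    unfolding section_map_def retraction_maps_def by blast
  from nontrivial_homology_if_section[OF this not_trivial_homology_nsphere]
  show ?thesis
    by (simp only: has_hole_def not_False_eq_True)
qed

section \<open>A while language compiled to Turing machines\<close>

text \<open>A program controls five tapes whose heads move together and appends to a sixth one, the
  output; it sees the list of the five symbols under the common head.\<close>

datatype com =
    Skip
  | Write nat nat
  | Move move
  | Emit bool
  | Seq com com
  | If "nat list \<Rightarrow> bool" com com
  | While "nat list \<Rightarrow> bool" com

text \<open>A step depends only on the remaining program and the scanned symbols, so it can serve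
  directly as a transition function. \<open>Skip\<close> steps to itself, like a halting
  state.\<close>

primrec com_step :: "com \<Rightarrow> nat list \<Rightarrow> com \<times> nat list \<times> move \<times> bool list" where
  "com_step Skip a = (Skip, a, Stay, [])"
| "com_step (Write i v) a = (Skip, a[i := v], Stay, [])"
| "com_step (Move d) a = (Skip, a, d, [])"
| "com_step (Emit b) a = (Skip, a, Stay, [b])"
| "com_step (Seq c1 c2) a =
     (if c1 = Skip then (c2, a, Stay, []) else (Seq (fst (com_step c1 a)) c2, snd (com_step c1 a)))"
| "com_step (If b c1 c2) a = (if b a then c1 else c2, a, Stay, [])"
| "com_step (While b c) a = (if b a then Seq c (While b c) else Skip, a, Stay, [])"

type_synonym store = "(nat \<Rightarrow> int \<Rightarrow> nat) \<times> int \<times> bool list"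

definition scanned :: "(nat \<Rightarrow> int \<Rightarrow> nat) \<Rightarrow> int \<Rightarrow> nat list" where
  "scanned C h = map (\<lambda>i. C i h) [0..<5]"

fun small_step :: "com \<times> store \<Rightarrow> com \<times> store" where
  "small_step (c, C, h, out) =
     (let (c', a, d, e) = com_step c (scanned C h)
      in (c', (\<lambda>i x. if i < 5 \<and> x = h then a ! i else C i x), shift d h, out @ e))"

declare small_step.simps [simp del]

text \<open>The step budget is part of the judgement, so the rules for the constructs also compose
  running times.\<close>

definition reaches :: "com \<Rightarrow> store \<Rightarrow> nat \<Rightarrow> store \<Rightarrow> bool" where
  "reaches c s B s' \<longleftrightarrow> (\<exists>t\<le>B. (small_step ^^ t) (c, s) = (Skip, s'))"

lemma length_scanned [simp]: "length (scanned C h) = 5"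
  by (simp add: scanned_def)

lemma nth_scanned [simp]: "i < 5 \<Longrightarrow> scanned C h ! i = C i h"
  by (simp add: scanned_def)

lemma write_scanned [simp]: "(\<lambda>i x. if i < 5 \<and> x = h then scanned C h ! i else C i x) = C"
  by (auto simp: fun_eq_iff)

lemma reaches_mono: "reaches c s B s' \<Longrightarrow> B \<le> B' \<Longrightarrow> reaches c s B' s'"
  unfolding reaches_def using le_trans by blast

lemma reaches_Suc:
  assumes "small_step (c, s) = (c', s')" "reaches c' s' B s''"
  shows "reaches c s (Suc B) s''"
proof -
  from assms(2) obtain t where "t \<le> B" "(small_step ^^ t) (c', s') = (Skip, s'')"
    unfolding reaches_def by blast
  then have "Suc t \<le> Suc B" "(small_step ^^ Suc t) (c, s) = (Skip, s'')"
    using assms(1) by (simp_all add: funpow_swap1)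
  then show ?thesis
    unfolding reaches_def by blast
qed

lemma reaches_Skip: "reaches Skip s B s"
  unfolding reaches_def by (rule exI[of _ 0]) simp

lemma reaches_Write:
  "i < 5 \<Longrightarrow> reaches (Write i v) (C, h, out) 1 (C(i := (C i)(h := v)), h, out)"
  unfolding One_nat_def
  by (rule reaches_Suc[OF _ reaches_Skip])
    (auto simp: small_step.simps fun_eq_iff nth_list_update)

lemma reaches_Move: "reaches (Move d) (C, h, out) 1 (C, shift d h, out)"
  unfolding One_nat_def
  by (rule reaches_Suc[OF _ reaches_Skip]) (simp add: small_step.simps)

lemma reaches_Emit: "reaches (Emit b) (C, h, out) 1 (C, h, out @ [b])"
  unfolding One_nat_def
  by (rule reaches_Suc[OF _ reaches_Skip]) (simp add: small_step.simps)

lemma small_step_Seq: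
  "c1 \<noteq> Skip \<Longrightarrow> small_step (Seq c1 c2, s) =
     (Seq (fst (small_step (c1, s))) c2, snd (small_step (c1, s)))"
  by (cases s) (simp add: small_step.simps Let_def split: prod.splits)

lemma reaches_Seq:
  assumes "reaches c1 s B1 s1" "reaches c2 s1 B2 s2"
  shows "reaches (Seq c1 c2) s (Suc (B1 + B2)) s2"
proof -
  from assms(1) obtain t where t: "t \<le> B1" "(small_step ^^ t) (c1, s) = (Skip, s1)"
    unfolding reaches_def by blast
  from t(2) have "reaches (Seq c1 c2) s (t + Suc B2) s2"
  proof (induction t arbitrary: c1 s)
    case 0
    then have "small_step (Seq c1 c2, s) = (c2, s1)"
      by (cases s1) (simp add: small_step.simps)
    from reaches_Suc[OF this assms(2)] show ?case by simp
  next
    case (Suc t)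
    obtain c' s' where step: "small_step (c1, s) = (c', s')" by (cases "small_step (c1, s)")
    with Suc.prems have "(small_step ^^ t) (c', s') = (Skip, s1)"
      by (simp add: funpow_swap1)
    note IH = Suc.IH[OF this]
    show ?case
    proof (cases "c1 = Skip")
      \<comment> \<open>A finished first program idles, so the remaining steps change nothing and
        the induction hypothesis already gives the result.\<close>
      case True
      then have "c' = c1" "s' = s"
        using step by (cases s, simp add: small_step.simps)+
      then show ?thesis
        using IH reaches_mono by fastforce
    next
      case False
      from reaches_Suc[OF _ IH] small_step_Seq[OF False, of c2 s] step show ?thesis
        by simp
    qed
  qed
  then show ?thesis
    by (rule reaches_mono) (use t(1) in simp)
qed

lemma reaches_If:
  assumes "b (scanned C h) \<Longrightarrow> reaches c1 (C, h, out) B s'"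
    and "\<not> b (scanned C h) \<Longrightarrow> reaches c2 (C, h, out) B s'"
  shows "reaches (If b c1 c2) (C, h, out) (Suc B) s'"
  by (rule reaches_Suc[of _ _ "if b (scanned C h) then c1 else c2" "(C, h, out)"])
    (use assms in \<open>auto simp: small_step.simps\<close>)

lemma reaches_While_end:
  assumes "\<not> b (scanned C h)"
  shows "reaches (While b c) (C, h, out) 1 (C, h, out)"
  unfolding One_nat_def
  by (rule reaches_Suc[OF _ reaches_Skip]) (use assms in \<open>simp add: small_step.simps\<close>)

lemma reaches_While:
  assumes "b (scanned C h)" "reaches c (C, h, out) B1 s1" "reaches (While b c) s1 B2 s2"
  shows "reaches (While b c) (C, h, out) (B1 + B2 + 2) s2"
proof -
  have "small_step (While b c, C, h, out) = (Seq c (While b c), C, h, out)"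
    using assms(1) by (simp add: small_step.simps)
  from reaches_Suc[OF this reaches_Seq[OF assms(2,3)]] show ?thesis by simp
qed

text \<open>The programs that may remain to be executed are the states of the Turing machine.\<close>

primrec conts :: "com \<Rightarrow> com set" where
  "conts Skip = {Skip}"
| "conts (Write i v) = {Write i v, Skip}"
| "conts (Move d) = {Move d, Skip}"
| "conts (Emit b) = {Emit b, Skip}"
| "conts (Seq c1 c2) = (\<lambda>c. Seq c c2) ` conts c1 \<union> conts c2"
| "conts (If b c1 c2) = insert (If b c1 c2) (conts c1 \<union> conts c2)"
| "conts (While b c) = {While b c, Skip} \<union> (\<lambda>c'. Seq c' (While b c)) ` conts c"

text \<open>Only written symbols can leave the alphabet. A tape index out of range makes the list
  update void, and guards may be arbitrary because a transition table over finitely many symbols can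
  be any function.\<close>

primrec wf_com :: "com \<Rightarrow> bool" where
  "wf_com Skip \<longleftrightarrow> True"
| "wf_com (Write i v) \<longleftrightarrow> v < 5"
| "wf_com (Move d) \<longleftrightarrow> True"
| "wf_com (Emit b) \<longleftrightarrow> True"
| "wf_com (Seq c1 c2) \<longleftrightarrow> wf_com c1 \<and> wf_com c2"
| "wf_com (If b c1 c2) \<longleftrightarrow> wf_com c1 \<and> wf_com c2"
| "wf_com (While b c) \<longleftrightarrow> wf_com c"

lemma finite_conts: "finite (conts c)"
  by (induction c) auto

lemma self_in_conts: "c \<in> conts c"
  by (induction c) auto

lemma Skip_in_conts: "Skip \<in> conts c"
  by (induction c) auto

lemma com_step_in_conts: "c' \<in> conts c \<Longrightarrow> fst (com_step c' a) \<in> conts c"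
proof (induction c arbitrary: c')
  case (Seq c1 c2)
  consider x where "c' = Seq x c2" "x \<in> conts c1" | "c' \<in> conts c2"
    using Seq.prems by auto
  then show ?case
  proof cases
    case 1
    then show ?thesis
      using Seq.IH(1)[of x] self_in_conts[of c2] by simp
  qed (use Seq.IH(2) in simp)
next
  case (If b c1 c2)
  consider "c' = If b c1 c2" | "c' \<in> conts c1" | "c' \<in> conts c2"
    using If.prems by auto
  then show ?case
    by cases (use If.IH self_in_conts[of c1] self_in_conts[of c2] in simp_all)
next
  case (While b c)
  consider "c' = While b c" | "c' = Skip" | x where "c' = Seq x (While b c)" "x \<in> conts c"
    using While.prems by auto
  then show ?case
  proof cases
    case 3
    then show ?thesis
      using While.IH[of x] by simp
  qed (use self_in_conts[of c] in simp_all)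
qed auto

lemma wf_conts: "wf_com c \<Longrightarrow> conts c \<subseteq> Collect wf_com"
  by (induction c) auto

lemma com_step_length:
  assumes "com_step c a = (c', a', d, e)"
  shows "length a' = length a" "length e \<le> 1"
proof -
  have "length (fst (snd (com_step c a))) = length a \<and> length (snd (snd (snd (com_step c a)))) \<le> 1"
    by (induction c) auto
  then show "length a' = length a" "length e \<le> 1"
    using assms by auto
qed

lemma com_step_symbols:
  assumes "com_step c a = (c', a', d, e)" "wf_com c" "set a \<subseteq> {..<5}"
  shows "set a' \<subseteq> {..<5}"
proof -
  have "set (fst (snd (com_step c a))) \<subseteq> {..<5}"
    using assms(2,3)
  proof (induction c)
    case (Write i v)
    then show ?case by (auto dest!: set_update_subset_insert[THEN subsetD])
  qed auto
  then show ?thesis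
    using assms(1) by auto
qed

text \<open>The state is decoded into a program, which is run on the five common symbols. The output
  head only moves right and stands on the first blank behind the output; if nothing is emitted, its
  symbol is written back.\<close>

definition machine :: "com \<Rightarrow> (com \<Rightarrow> nat) \<Rightarrow> tm" where
  "machine c \<iota> =
     \<lparr>ntapes = 6, nsymbols = 5, nstates = card (conts c), init_state = \<iota> c, halt_state = \<iota> Skip,
      delta = (\<lambda>q a.
        let (c', a', d, e) = com_step (the_inv_into (conts c) \<iota> q) (butlast a)
        in (\<iota> c', map (\<lambda>v. (v, d)) a' @
              [if e = [] then (last a, Stay) else (if hd e then 2 else 1, Right)]))\<rparr>"

definition tapes :: "store \<Rightarrow> tape list" where
  "tapes s = (case s of (C, h, out) \<Rightarrow>
     map (\<lambda>i. (C i, h)) [0..<5] @ [(tape_content out, int (length out))])"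

lemma tape_content_snoc:
  "(tape_content out)(int (length out) := if b then 2 else 1) = tape_content (out @ [b])"
  by (auto simp: tape_content_def fun_eq_iff nth_append)

lemma wf_machine:
  assumes wf: "wf_com c" and \<iota>: "bij_betw \<iota> (conts c) {..<card (conts c)}"
  shows "wf_tm (machine c \<iota>)"
proof -
  have lt: "\<iota> c' < card (conts c)" if "c' \<in> conts c" for c'
    using bij_betwE[OF \<iota>] that by simp
  have "fst (delta (machine c \<iota>) q a) < card (conts c) \<and>
      length (snd (delta (machine c \<iota>) q a)) = 6 \<and>
      fst ` set (snd (delta (machine c \<iota>) q a)) \<subseteq> {..<5}"
    if q: "q < card (conts c)" and a: "length a = 6" "set a \<subseteq> {..<5}" for q a
  proof -
    define k where "k = the_inv_into (conts c) \<iota> q"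
    have k: "k \<in> conts c"
      unfolding k_def using \<iota> q by (intro the_inv_into_into[OF _ _ subset_refl]) (auto simp: bij_betw_def)
    obtain c' a' d e where step: "com_step k (butlast a) = (c', a', d, e)"
      by (cases "com_step k (butlast a)")
    have sub: "set (butlast a) \<subseteq> {..<5}"
      using a(2) in_set_butlastD by fastforce
    have "wf_com k"
      using wf_conts[OF wf] k by auto
    note st = com_step_length[OF step] com_step_symbols[OF step this sub]
    have "last a \<in> set a"
      using a(1) by (intro last_in_set) auto
    then have "last a < 5" using a(2) by auto
    moreover have "c' \<in> conts c"
      using com_step_in_conts[OF k, of "butlast a"] step by simp
    ultimately show ?thesis
      using st a(1) step unfolding k_def by (auto simp add: machine_def lt)
  qed
  then show ?thesis
    using lt self_in_conts[of c] Skip_in_conts[of c] by (auto simp: wf_tm_def machine_def)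
qed

text \<open>The simulation is step for step, so a budget for \<open>reaches\<close> is a time bound
  for the machine. Idling in \<open>Skip\<close> matches the fixed halting configuration.\<close>

lemma tm_step_machine:
  assumes \<iota>: "bij_betw \<iota> (conts c) {..<card (conts c)}" and k: "k \<in> conts c"
    and s: "small_step (k, s) = (k', s')"
  shows "tm_step (machine c \<iota>) (\<iota> k, tapes s) = (\<iota> k', tapes s')" "k' \<in> conts c"
proof -
  obtain C h out where s_def: "s = (C, h, out)" by (cases s)
  obtain c' a' d e where step: "com_step k (scanned C h) = (c', a', d, e)"
    by (cases "com_step k (scanned C h)")
  have k': "k' = c'"
    and s': "s' = (\<lambda>i x. if i < 5 \<and> x = h then a' ! i else C i x, shift d h, out @ e)"
    using s step by (simp_all add: s_def small_step.simps)
  show "k' \<in> conts c"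
    using com_step_in_conts[OF k, of "scanned C h"] step k' by simp
  have inj: "inj_on \<iota> (conts c)"
    using \<iota> by (simp add: bij_betw_def)
  have len: "length a' = 5 \<and> length e \<le> 1"
    using com_step_length[OF step] by simp
  show "tm_step (machine c \<iota>) (\<iota> k, tapes s) = (\<iota> k', tapes s')"
  proof (cases "k = Skip")
    case True
    with step have "k' = Skip" "s' = s"
      by (auto simp: k' s' s_def fun_eq_iff)
    with True show ?thesis
      by (simp add: tm_step_def machine_def)
  next
    case False
    have ne: "\<iota> k \<noteq> \<iota> Skip"
      using inj_onD[OF inj _ k Skip_in_conts] False by blast
    have inv: "the_inv_into (conts c) \<iota> (\<iota> k) = k"
      by (rule the_inv_into_f_f[OF inj k])
    have read: "map read_tape (tapes s) = scanned C h @ [0]"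
      by (simp add: tapes_def s_def scanned_def read_tape_def tape_content_def comp_def)
    have "map2 act_tape (map (\<lambda>v. (v, d)) a') (map (\<lambda>i. (C i, h)) [0..<5]) =
        map (\<lambda>i. (\<lambda>x. if x = h then a' ! i else C i x, shift d h)) [0..<5]"
      using len by (intro nth_equalityI) (auto simp: act_tape_def fun_eq_iff)
    moreover have "act_tape (if e = [] then (0, Stay) else (if hd e then 2 else 1, Right))
        (tape_content out, int (length out)) = (tape_content (out @ e), int (length (out @ e)))"
    proof (cases e)
      case Nil
      then show ?thesis
        by (auto simp: act_tape_def fun_eq_iff tape_content_def)
    next
      case (Cons b e')
      with len have "e = [b]" by simp
      then show ?thesis
        using tape_content_snoc[of out b] by (simp add: act_tape_def)
    qed
    ultimately have "map2 act_tape (map (\<lambda>v. (v, d)) a' @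
         [if e = [] then (0, Stay) else (if hd e then 2 else 1, Right)]) (tapes s) = tapes s'"
      using len by (simp add: tapes_def s_def s' cong: map_cong)
    moreover have "delta (machine c \<iota>) (\<iota> k) (map read_tape (tapes s)) = (\<iota> k', map (\<lambda>v. (v, d)) a' @
         [if e = [] then (0, Stay) else (if hd e then 2 else 1, Right)])"
      unfolding read by (simp add: machine_def inv step k')
    moreover have "halt_state (machine c \<iota>) = \<iota> Skip"
      by (simp add: machine_def)
    ultimately show ?thesis
      unfolding tm_step_def Let_def fst_conv snd_conv using ne by (simp only: if_False fst_conv snd_conv)
  qed
qed

lemma polytime_computableI:
  assumes wf: "wf_com c"
    and run: "\<And>w. \<exists>C h. reaches c ((\<lambda>i. tape_content (if i = 0 then w else [])), 0, [])
                      (poly p (length w)) (C, h, g w)"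
  shows "polytime_computable g"
proof -
  obtain \<iota> where \<iota>: "bij_betw \<iota> (conts c) {..<card (conts c)}"
    using ex_bij_betw_finite_nat[OF finite_conts] by (auto simp: atLeast0LessThan)
  let ?M = "machine c \<iota>"
  have sim: "(tm_step ?M ^^ t) (\<iota> k, tapes s) = (\<iota> k', tapes s')"
    if "k \<in> conts c" "(small_step ^^ t) (k, s) = (k', s')" for t k s k' s'
    using that
  proof (induction t arbitrary: k s)
    case (Suc t)
    obtain k1 s1 where st: "small_step (k, s) = (k1, s1)" by (cases "small_step (k, s)")
    with Suc.prems have "(small_step ^^ t) (k1, s1) = (k', s')"
      by (simp add: funpow_swap1)
    from Suc.IH[OF tm_step_machine(2)[OF \<iota> Suc.prems(1) st] this]
    show ?case
      by (simp add: funpow_swap1 tm_step_machine(1)[OF \<iota> Suc.prems(1) st])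
  qed simp
  have "\<exists>t\<le>poly p (length w). let r = (tm_step ?M ^^ t) (init_config ?M w)
      in fst r = halt_state ?M \<and> fst (last (snd r)) = tape_content (g w)" for w
  proof -
    let ?s = "((\<lambda>i. tape_content (if i = 0 then w else [])), 0, []) :: store"
    from run[of w] obtain C h t where t: "t \<le> poly p (length w)"
        "(small_step ^^ t) (c, ?s) = (Skip, C, h, g w)"
      unfolding reaches_def by blast
    have "init_config ?M w = (\<iota> c, tapes ?s)"
      by (simp add: init_config_def machine_def tapes_def upt_rec numeral_eq_Suc)
    with t sim[OF self_in_conts t(2)] show ?thesis
      by (intro exI[of _ t]) (simp add: machine_def tapes_def)
  qed
  with wf_machine[OF wf \<iota>] show ?thesis
    unfolding polytime_computable_def by (intro exI[of _ ?M] exI[of _ p] conjI allI)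
qed

section \<open>Loops over the positions of a word\<close>

text \<open>The symbols 3 and 4 delimit the input, which starts at cell 0: position \<open>i\<close> is cell \<open>i - 1\<close>.
  Tape \<open>j\<close> stores the loop counter \<open>m j\<close> as a mark at that position.\<close>

definition word_tape :: "bool list \<Rightarrow> int \<Rightarrow> nat" where
  "word_tape w i = (if i = -1 then 3 else if i = int (length w) then 4 else tape_content w i)"

definition mark_tapes :: "bool list \<Rightarrow> (nat \<Rightarrow> nat) \<Rightarrow> nat \<Rightarrow> int \<Rightarrow> nat" where
  "mark_tapes w m j = (if j = 0 then word_tape w
     else if j < 5 then (\<lambda>x. if x = int (m j) - 1 then 1 else 0) else (\<lambda>x. 0))"

abbreviation framed_length :: "bool list \<Rightarrow> nat" where
  "framed_length w \<equiv> length w + 2"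

text \<open>\<open>Z\<close> contains the counters that \<open>P\<close> may use for loops; they have to be 0 and are reset to 0.\<close>

definition emits :: "nat set \<Rightarrow> com \<Rightarrow> (bool list \<Rightarrow> (nat \<Rightarrow> nat) \<Rightarrow> bool list) \<Rightarrow> nat poly \<Rightarrow> bool" where
  "emits Z P s p \<longleftrightarrow> wf_com P \<and>
     (\<forall>w m out. (\<forall>j. m j < framed_length w) \<longrightarrow> (\<forall>j\<in>Z. m j = 0) \<longrightarrow>
        reaches P (mark_tapes w m, -1, out) (poly p (length w)) (mark_tapes w m, -1, out @ s w m))"

definition emitting :: "nat set \<Rightarrow> com \<Rightarrow> (bool list \<Rightarrow> (nat \<Rightarrow> nat) \<Rightarrow> bool list) \<Rightarrow> bool" where
  "emitting Z P s \<longleftrightarrow> (\<exists>p. emits Z P s p)"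

definition go_home :: com where
  "go_home = While (\<lambda>a. a ! 0 \<noteq> 3) (Move Left)"

definition go_mark :: "nat \<Rightarrow> com" where
  "go_mark k = While (\<lambda>a. a ! k \<noteq> 1) (Move Right)"

text \<open>The cost 3 of a round consists of unfolding the loop, moving, and dropping the finished
  body.\<close>

lemma reaches_While_Move:
  assumes "b (scanned C h)" "reaches (While b (Move d)) (C, shift d h, out) B s"
  shows "reaches (While b (Move d)) (C, h, out) (B + 3) s"
  using reaches_While[of b, OF assms(1) reaches_Move assms(2)] by (simp add: eval_nat_numeral)

lemma word_tape_eq_3_iff: "word_tape w i = 3 \<longleftrightarrow> i = -1"
  by (auto simp: word_tape_def tape_content_def)

lemma word_tape_eq_4_iff: "word_tape w i = 4 \<longleftrightarrow> i = int (length w)"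
  by (auto simp: word_tape_def tape_content_def)

lemma reaches_go_home_aux:
  assumes "C 0 = word_tape w"
  shows "reaches go_home (C, int n - 1, out) (3 * n + 1) (C, -1, out)"
proof (induction n)
  case 0
  show ?case
    unfolding go_home_def
    using reaches_While_end[of "\<lambda>a. a ! 0 \<noteq> 3" C "-1" "Move Left" out] assms
    by (simp add: word_tape_eq_3_iff)
next
  case (Suc n)
  have "reaches go_home (C, int n, out) (3 * n + 1 + 3) (C, -1, out)"
    unfolding go_home_def
    by (rule reaches_While_Move)
      (use Suc.IH[unfolded go_home_def] in \<open>simp_all add: assms word_tape_eq_3_iff\<close>)
  then show ?case by simp
qed

lemma reaches_go_home:
  assumes "C 0 = word_tape w" "-1 \<le> h"
  shows "reaches go_home (C, h, out) (3 * nat (h + 1) + 1) (C, -1, out)"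
  using reaches_go_home_aux[where C = C and w = w and n = "nat (h + 1)"] assms by simp

lemma reaches_go_mark:
  assumes "k < 5" and "\<And>x. C k x = 1 \<longleftrightarrow> x = int n - 1"
  shows "reaches (go_mark k) (C, -1, out) (3 * n + 1) (C, int n - 1, out)"
proof -
  \<comment> \<open>The induction is on the distance \<open>j\<close> to the only mark on tape
    \<open>k\<close>.\<close>
  have "reaches (go_mark k) (C, int n - 1 - int j, out) (3 * j + 1) (C, int n - 1, out)" for j
  proof (induction j)
    case 0
    show ?case
      unfolding go_mark_def
      using reaches_While_end[of "\<lambda>a. a ! k \<noteq> 1" C "int n - 1" "Move Right" out] assms
      by simp
  next
    case (Suc j)
    have "reaches (go_mark k) (C, int n - 1 - int (Suc j), out) (3 * j + 1 + 3) (C, int n - 1, out)"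
      unfolding go_mark_def
      by (rule reaches_While_Move)
        (use Suc.IH[unfolded go_mark_def] assms in \<open>simp_all add: algebra_simps\<close>)
    then show ?case by simp
  qed
  from this[of n] show ?thesis by simp
qed

lemma emitting_Emit: "emitting Z (Emit b) (\<lambda>w m. [b])"
  unfolding emitting_def emits_def
  by (rule exI[of _ 1]) (simp add: reaches_Emit[simplified])

lemma emitting_Skip: "emitting Z Skip (\<lambda>w m. [])"
  unfolding emitting_def emits_def
  by (rule exI[of _ 1]) (simp add: reaches_Skip)

lemma emitting_Seq:
  assumes "emitting Z P s" "emitting Z Q t"
  shows "emitting Z (Seq P Q) (\<lambda>w m. s w m @ t w m)"
proof -
  from assms obtain p q where pq: "emits Z P s p" "emits Z Q t q"
    unfolding emitting_def by blast
  have "emits Z (Seq P Q) (\<lambda>w m. s w m @ t w m) (p + q + 1)"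
    unfolding emits_def
  proof (intro conjI allI impI)
    show "wf_com (Seq P Q)"
      using pq by (simp add: emits_def)
    fix w m out
    assume m: "\<forall>j. m j < framed_length w" "\<forall>j\<in>Z. m j = 0"
    have "reaches P (mark_tapes w m, -1, out) (poly p (length w)) (mark_tapes w m, -1, out @ s w m)"
      "reaches Q (mark_tapes w m, -1, out @ s w m) (poly q (length w))
         (mark_tapes w m, -1, (out @ s w m) @ t w m)"
      using pq m unfolding emits_def by blast+
    from reaches_Seq[OF this]
    show "reaches (Seq P Q) (mark_tapes w m, -1, out) (poly (p + q + 1) (length w))
        (mark_tapes w m, -1, out @ s w m @ t w m)"
      by simp
  qed
  then show ?thesis
    unfolding emitting_def by blast
qed

lemma reaches_go_marked:
  assumes "k \<in> {1..<5}" "n = m k"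
  shows "reaches (go_mark k) (mark_tapes w m, -1, out) (3 * n + 1) (mark_tapes w m, int n - 1, out)"
  using assms by (intro reaches_go_mark) (auto simp: mark_tapes_def)

text \<open>Both branches first bring the head back to cell -1, because \<open>emits\<close> expects
  every program to start and end there.\<close>

definition At :: "nat \<Rightarrow> move \<Rightarrow> (nat list \<Rightarrow> bool) \<Rightarrow> com \<Rightarrow> com \<Rightarrow> com" where
  "At k d b P Q = Seq (go_mark k) (Seq (Move d) (If b (Seq go_home P) (Seq go_home Q)))"

lemma wf_go [simp]: "wf_com go_home" "wf_com (go_mark k)"
  by (simp_all add: go_home_def go_mark_def)

text \<open>With \<open>d \<noteq> Left\<close> the head never gets to the left of cell -1, from
  where \<open>go_home\<close> would search for the left end marker forever.\<close>

lemma emitting_At: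
  assumes k: "k \<in> {1..<5}" and d: "d \<noteq> Left" and PQ: "emitting Z P s" "emitting Z Q t"
  shows "emitting Z (At k d b P Q)
    (\<lambda>w m. if b (scanned (mark_tapes w m) (shift d (int (m k) - 1))) then s w m else t w m)"
proof -
  from PQ obtain p q where pq: "emits Z P s p" "emits Z Q t q"
    unfolding emitting_def by blast
  \<comment> \<open>The slope 6 pays for the walk to the mark and the walk back, each with 3 steps
    per cell; the constant 30 is generous.\<close>
  have "emits Z (At k d b P Q)
    (\<lambda>w m. if b (scanned (mark_tapes w m) (shift d (int (m k) - 1))) then s w m else t w m)
    (p + q + [:30, 6:])"
    unfolding emits_def
  proof (intro conjI allI impI)
    show "wf_com (At k d b P Q)"
      using pq by (simp add: emits_def At_def)
    fix w m out
    assume m: "\<forall>j. m j < framed_length w" "\<forall>j\<in>Z. m j = 0"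
    let ?C = "mark_tapes w m"
    let ?h = "shift d (int (m k) - 1)"
    let ?H = "3 * (length w + 3) + 1"
    have h: "-1 \<le> ?h" "nat (?h + 1) \<le> length w + 3"
      using m(1)[rule_format, of k] d by (cases d; simp)+
    have home: "reaches go_home (?C, ?h, out) ?H (?C, -1, out)"
      by (rule reaches_mono[OF reaches_go_home[of _ w]]) (use h in \<open>auto simp: mark_tapes_def\<close>)
    have mk: "reaches (go_mark k) (?C, -1, out) ?H (?C, int (m k) - 1, out)"
      by (rule reaches_mono[OF reaches_go_marked[OF k refl]]) (use m(1)[rule_format, of k] in simp)
    have P: "reaches P (?C, -1, out) (poly p (length w)) (?C, -1, out @ s w m)"
      and Q: "reaches Q (?C, -1, out) (poly q (length w)) (?C, -1, out @ t w m)"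
      using pq m unfolding emits_def by blast+
    let ?r = "if b (scanned ?C ?h) then s w m else t w m"
    have "reaches (If b (Seq go_home P) (Seq go_home Q)) (?C, ?h, out)
        (Suc (Suc (?H + (poly p (length w) + poly q (length w))))) (?C, -1, out @ ?r)"
      by (rule reaches_If) (auto intro!: reaches_Seq[OF home, THEN reaches_mono] P Q)
    from reaches_Seq[OF mk reaches_Seq[OF reaches_Move[of d] this]]
    show "reaches (At k d b P Q) (?C, -1, out) (poly (p + q + [:30, 6:]) (length w)) (?C, -1, out @ ?r)"
      unfolding At_def by (rule reaches_mono) simp
  qed
  then show ?thesis
    unfolding emitting_def by blast
qed

text \<open>The counter is 0 on entry, so the first run of \<open>P\<close> needs no preparation.
  Each round then shifts the mark by one cell, until it lies on the right end marker; finally it is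
  put back to cell -1. The body may not use counter \<open>k\<close> for its own loops.\<close>

definition For :: "nat \<Rightarrow> com \<Rightarrow> com" where
  "For k P = Seq P (Seq (go_mark k)
     (Seq (While (\<lambda>a. a ! 0 \<noteq> 4)
            (Seq (Write k 0) (Seq (Move Right) (Seq (Write k 1) (Seq go_home (Seq P (go_mark k)))))))
          (Seq (Write k 0) (Seq go_home (Write k 1)))))"

lemma mark_tapes_update:
  assumes "k \<in> {1..<5}" "i = m k" "int j = x + 1"
  shows "(mark_tapes w m)(k := ((mark_tapes w m) k)(int i - 1 := 0),
     k := (((mark_tapes w m)(k := ((mark_tapes w m) k)(int i - 1 := 0))) k)(x := 1)) = mark_tapes w (m(k := j))"
  using assms by (auto simp: mark_tapes_def fun_eq_iff)

lemma emitting_For: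
  assumes k: "k \<in> {1..<5}" "k \<in> Z" and P: "emitting (Z - {k}) P s"
  shows "emitting Z (For k P) (\<lambda>w m. concat (map (\<lambda>i. s w (m(k := i))) [0..<framed_length w]))"
proof -
  from P obtain p where p: "emits (Z - {k}) P s p"
    unfolding emitting_def by blast
  let ?b = "\<lambda>a :: nat list. a ! 0 \<noteq> 4"
  let ?body = "Seq (Write k 0) (Seq (Move Right) (Seq (Write k 1) (Seq go_home (Seq P (go_mark k)))))"
  \<comment> \<open>After the run for position 0 there are \<open>length w + 1\<close> rounds; the
    larger factor \<open>length w + 3\<close> absorbs that first run as well.\<close>
  have "emits Z (For k P) (\<lambda>w m. concat (map (\<lambda>i. s w (m(k := i))) [0..<framed_length w]))
    ((p + [:30, 6:]) * [:3, 1:] + [:50, 10:])"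
    unfolding emits_def
  proof (intro conjI allI impI)
    show "wf_com (For k P)"
      using p by (simp add: emits_def For_def)
    fix w m out
    assume m: "\<forall>j. m j < framed_length w" "\<forall>j\<in>Z. m j = 0"
    let ?C = "\<lambda>i. mark_tapes w (m(k := i))"
    let ?s = "\<lambda>i. s w (m(k := i))"
    let ?p = "poly p (length w)"
    let ?D = "?p + 6 * length w + 25"
    let ?N = "framed_length w"
    have P: "reaches P (?C i, -1, out) ?p (?C i, -1, out @ ?s i)" if "i < ?N" for i out
      by (rule p[unfolded emits_def, THEN conjunct2, rule_format]) (use m that in auto)
    have mk: "reaches (go_mark k) (?C i, -1, out) (3 * i + 1) (?C i, int i - 1, out)" for i out
      by (rule reaches_go_marked[OF k(1)]) simp
    have hm: "reaches go_home (?C i, int n - 1, out) (3 * n + 1) (?C i, -1, out)" for i n out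
      by (rule reaches_go_home_aux[of _ w]) (simp add: mark_tapes_def)
    have C0: "?C 0 = mark_tapes w m"
      using m(2) k(2) by (metis fun_upd_triv)
    have upd: "(?C i)(k := ((?C i) k)(int i - 1 := 0),
        k := (((?C i)(k := ((?C i) k)(int i - 1 := 0))) k)(int j - 1 := 1)) = ?C j" for i j
      using mark_tapes_update[OF k(1), of i "m(k := i)" j "int j - 1" w] by simp
    have k5: "k < 5" using k(1) by simp
    have body: "reaches ?body (?C i, int i - 1, out) ?D (?C (Suc i), int (Suc i) - 1, out @ ?s (Suc i))"
      if i: "Suc i < ?N" for i out
    proof -
      note w1 = reaches_Write[OF k5, of 0 "?C i" "int i - 1" out]
      let ?C' = "(?C i)(k := ((?C i) k)(int i - 1 := 0))"
      have mv: "reaches (Move Right) (?C', int i - 1, out) 1 (?C', int (Suc i) - 1, out)"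
        using reaches_Move[of Right ?C' "int i - 1" out] by simp
      have w2: "reaches (Write k 1) (?C', int (Suc i) - 1, out) 1 (?C (Suc i), int (Suc i) - 1, out)"
        using reaches_Write[OF k5, of 1 ?C' "int (Suc i) - 1" out] unfolding upd .
      from reaches_Seq[OF w1 reaches_Seq[OF mv reaches_Seq[OF w2
            reaches_Seq[OF hm[of "Suc i" "Suc i" out] reaches_Seq[OF P[OF i] mk]]]]]
      show ?thesis
        by (rule reaches_mono) (use i in simp)
    qed
    \<comment> \<open>The induction is on the number \<open>n\<close> of positions still to be
      visited, with the run of \<open>P\<close> for \<open>i\<close> already done.\<close>
    have last: "i < ?N \<Longrightarrow> i + n = ?N - 1 \<Longrightarrow> reaches (While ?b ?body) (?C i, int i - 1, out) ((?D + 2) * n + 1)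
       (?C (?N - 1), int (?N - 1) - 1, out @ concat (map ?s [Suc i..<?N]))" for i n out
    proof (induction n arbitrary: i out)
      case 0
      then have i: "i = ?N - 1" by simp
      have "\<not> ?b (scanned (?C i) (int i - 1))"
        using i by (simp add: mark_tapes_def word_tape_eq_4_iff)
      from reaches_While_end[of ?b, OF this, of ?body out] i show ?case
        by (simp add: fun_upd_def)
    next
      case (Suc n)
      then have i: "Suc i < ?N" by simp
      have b: "?b (scanned (?C i) (int i - 1))"
        using i by (simp add: mark_tapes_def word_tape_eq_4_iff)
      have "reaches (While ?b ?body) (?C (Suc i), int (Suc i) - 1, out @ ?s (Suc i)) ((?D + 2) * n + 1)
         (?C (?N - 1), int (?N - 1) - 1, (out @ ?s (Suc i)) @ concat (map ?s [Suc (Suc i)..<?N]))"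
        by (rule Suc.IH) (use Suc.prems in auto)
      from reaches_While[of ?b, OF b body[OF i] this]
      have "reaches (While ?b ?body) (?C i, int i - 1, out) ((?D + 2) * Suc n + 1)
        (?C (?N - 1), int (?N - 1) - 1, (out @ ?s (Suc i)) @ concat (map ?s [Suc (Suc i)..<?N]))"
        by (rule reaches_mono) simp
      moreover have "[Suc i..<?N] = Suc i # [Suc (Suc i)..<?N]"
        using i by (intro upt_conv_Cons) simp
      ultimately show ?case by (simp only: list.map concat.simps append_assoc)
    qed
    have N: "0 < ?N" by simp
    let ?l = "?N - 1"
    let ?C' = "(?C ?l)(k := ((?C ?l) k)(int ?l - 1 := 0))"
    let ?o = "(out @ ?s 0) @ concat (map ?s [Suc 0..<?N])"
    note w1 = reaches_Write[OF k5, of 0 "?C ?l" "int ?l - 1" ?o]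
    have hm': "reaches go_home (?C', int ?l - 1, ?o) (3 * ?l + 1) (?C', -1, ?o)"
      by (rule reaches_go_home_aux[of _ w]) (use k in \<open>simp add: mark_tapes_def\<close>)
    have w2: "reaches (Write k 1) (?C', -1, ?o) 1 (?C 0, -1, ?o)"
      using reaches_Write[OF k5, of 1 ?C' "int 0 - 1" ?o] unfolding upd by simp
    have mk0: "reaches (go_mark k) (?C 0, -1, out @ ?s 0) 1 (?C 0, int 0 - 1, out @ ?s 0)"
      using mk[of 0] by simp
    have "reaches (While ?b ?body) (?C 0, int 0 - 1, out @ ?s 0) ((?D + 2) * ?l + 1)
       (?C ?l, int ?l - 1, ?o)"
      by (rule last) auto
    from reaches_Seq[OF P[OF N, of out] reaches_Seq[OF mk0 reaches_Seq[OF this reaches_Seq[OF w1 reaches_Seq[OF hm' w2]]]]]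
    have "reaches (For k P) (?C 0, -1, out) (poly ((p + [:30, 6:]) * [:3, 1:] + [:50, 10:]) (length w)) (?C 0, -1, ?o)"
      unfolding For_def
    proof (rule reaches_mono)
      have bound: "poly ((p + [:30, 6:]) * [:3, 1:] + [:50, 10:]) (length w) =
          (?p + 30 + 6 * length w) * (3 + length w) + 50 + 10 * length w"
        by (simp add: algebra_simps)
      have l: "?l = length w + 1" by simp
      show "Suc (?p + Suc (1 + Suc ((?D + 2) * ?l + 1 + Suc (1 + Suc (3 * ?l + 1 + 1))))) \<le>
          poly ((p + [:30, 6:]) * [:3, 1:] + [:50, 10:]) (length w)"
        unfolding bound l by (simp add: algebra_simps)
    qed
    moreover have "[0..<?N] = 0 # [Suc 0..<?N]"
      by (rule upt_conv_Cons) simp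
    ultimately show "reaches (For k P) (mark_tapes w m, -1, out)
       (poly ((p + [:30, 6:]) * [:3, 1:] + [:50, 10:]) (length w))
       (mark_tapes w m, -1, out @ concat (map ?s [0..<?N]))"
      by (simp only: C0 list.map concat.simps append_assoc)
  qed
  then show ?thesis
    unfolding emitting_def by blast
qed

section \<open>Framing the input and placing the marks\<close>

definition set_up :: com where
  "set_up = Seq (Move Left) (Seq (Write 0 3) (Seq (Write 1 1) (Seq (Write 2 1) (Seq (Write 3 1) (Seq (Write 4 1)
     (Seq (Move Right) (Seq (While (\<lambda>a. a ! 0 \<noteq> 0) (Move Right)) (Seq (Write 0 4) go_home))))))))"

lemma reaches_set_up:
  "reaches set_up ((\<lambda>i. tape_content (if i = 0 then w else [])), 0, [])
     (poly [:50, 6:] (length w)) (mark_tapes w (\<lambda>_. 0), -1, [])"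
proof -
  define C0 where "C0 = (\<lambda>i::nat. tape_content (if i = 0 then w else []))"
  define C1 where "C1 = mark_tapes w (\<lambda>_. 0)"
  \<comment> \<open>\<open>C2\<close> is the final store without the right end marker: the writes at
    cell -1 pass through \<open>D0\<close> to \<open>D3\<close> and end in \<open>C2\<close>. The
    first blank found from there is the end of the input.\<close>
  define C2 where "C2 = C1(0 := (C1 0)(int (length w) := 0))"
  define D0 where "D0 = C0(0 := (C0 0)(-1 := 3))"
  define D1 where "D1 = D0(1 := (D0 1)(-1 := 1))"
  define D2 where "D2 = D1(2 := (D1 2)(-1 := 1))"
  define D3 where "D3 = D2(3 := (D2 3)(-1 := 1))"
  have D4: "D3(4 := (D3 4)(-1 := 1)) = C2"
  proof (intro ext)
    fix i :: nat and x :: int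
    consider "i = 0" | "i = 1" | "i = 2" | "i = 3" | "i = 4" | "i \<ge> 5" by linarith
    then show "(D3(4 := (D3 4)(-1 := 1))) i x = C2 i x"
      by cases (simp_all add: D0_def D1_def D2_def D3_def C0_def C1_def C2_def mark_tapes_def
          word_tape_def tape_content_def)
  qed
  have w: "reaches (Write 0 3) (C0, -1, []) 1 (D0, -1, [])"
    "reaches (Write 1 1) (D0, -1, []) 1 (D1, -1, [])"
    "reaches (Write 2 1) (D1, -1, []) 1 (D2, -1, [])"
    "reaches (Write 3 1) (D2, -1, []) 1 (D3, -1, [])"
    "reaches (Write 4 1) (D3, -1, []) 1 (C2, -1, [])"
    unfolding D0_def D1_def D2_def D3_def D4[unfolded D0_def D1_def D2_def D3_def, symmetric]
    by (rule reaches_Write, simp)+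
  have loop: "n \<le> length w \<Longrightarrow> reaches (While (\<lambda>a. a ! 0 \<noteq> 0) (Move Right)) (C2, int (length w) - int n, [])
      (3 * n + 1) (C2, int (length w), [])" for n
  proof (induction n)
    case 0
    show ?case
      using reaches_While_end[of "\<lambda>a. a ! 0 \<noteq> 0" C2 "int (length w)" "Move Right" "[]"] by (simp add: C2_def fun_upd_def)
  next
    case (Suc n)
    have "C2 0 (int (length w) - int (Suc n)) \<noteq> 0"
      using Suc.prems by (auto simp: C2_def C1_def mark_tapes_def word_tape_def tape_content_def)
    then have "reaches (While (\<lambda>a. a ! 0 \<noteq> 0) (Move Right)) (C2, int (length w) - int (Suc n), [])
      (3 * n + 1 + 3) (C2, int (length w), [])"
      using Suc by (intro reaches_While_Move) (simp_all add: algebra_simps)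
    then show ?case by simp
  qed
  have fin: "reaches (Write 0 4) (C2, int (length w), []) 1 (C1, int (length w), [])"
  proof -
    have "C2(0 := (C2 0)(int (length w) := 4)) = C1"
      by (auto simp: fun_eq_iff C1_def C2_def mark_tapes_def word_tape_def)
    then show ?thesis
      using reaches_Write[of 0 4 C2 "int (length w)" "[]"] by simp
  qed
  have home: "reaches go_home (C1, int (length w), []) (3 * nat (int (length w) + 1) + 1) (C1, -1, [])"
    by (rule reaches_go_home[of _ w]) (auto simp: C1_def mark_tapes_def)
  have mvL: "reaches (Move Left) (C0, 0, []) 1 (C0, -1, [])"
    using reaches_Move[of Left C0 0 "[]"] by simp
  have mvR: "reaches (Move Right) (C2, -1, []) 1 (C2, int (length w) - int (length w), [])"
    using reaches_Move[of Right C2 "-1" "[]"] by simp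
  note tail = reaches_Seq[OF mvR reaches_Seq[OF loop[OF order_refl] reaches_Seq[OF fin home]]]
  from reaches_Seq[OF mvL reaches_Seq[OF w(1) reaches_Seq[OF w(2) reaches_Seq[OF w(3)
         reaches_Seq[OF w(4) reaches_Seq[OF w(5) tail]]]]]]
  have "reaches set_up (C0, 0, []) (poly [:50, 6:] (length w)) (C1, -1, [])"
    unfolding set_up_def by (rule reaches_mono) simp
  then show ?thesis
    unfolding C0_def C1_def .
qed

lemma polytime_computable_if_emitting:
  assumes "emitting UNIV P s"
  shows "polytime_computable (\<lambda>w. s w (\<lambda>_. 0))"
proof -
  from assms obtain p where p: "emits UNIV P s p"
    unfolding emitting_def by blast
  show ?thesis
  proof (rule polytime_computableI)
    show "wf_com (Seq set_up P)"
      using p by (simp add: emits_def set_up_def)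
    fix w
    have "reaches P (mark_tapes w (\<lambda>_. 0), -1, []) (poly p (length w))
        (mark_tapes w (\<lambda>_. 0), -1, [] @ s w (\<lambda>_. 0))"
      by (rule p[unfolded emits_def, THEN conjunct2, rule_format]) simp_all
    from reaches_Seq[OF reaches_set_up this]
    show "\<exists>C h. reaches (Seq set_up P) ((\<lambda>i. tape_content (if i = 0 then w else [])), 0, [])
        (poly ([:50, 6:] + p + 1) (length w)) (C, h, s w (\<lambda>_. 0))"
      by (intro exI[of _ "mark_tapes w (\<lambda>_. 0)"] exI[of _ "-1"]) simp
  qed
qed

section \<open>Generating the polynomial\<close>

lemma emitting_cong:
  assumes "emitting Z P s" and "\<And>w m. \<forall>j. m j < framed_length w \<Longrightarrow> s w m = t w m"
  shows "emitting Z P t"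
proof -
  from assms(1) obtain p where "emits Z P s p"
    unfolding emitting_def by (rule exE)
  then have "emits Z P t p"
    unfolding emits_def using assms(2) by simp
  then show ?thesis
    unfolding emitting_def by (rule exI)
qed

definition seqs :: "com list \<Rightarrow> com" where
  "seqs Ps = foldr Seq Ps Skip"

lemma emitting_seqs:
  assumes "\<And>x. x \<in> set xs \<Longrightarrow> emitting Z (P x) (s x)"
  shows "emitting Z (seqs (map P xs)) (\<lambda>w m. concat (map (\<lambda>x. s x w m) xs))"
  using assms
proof (induction xs)
  case Nil
  then show ?case by (simp add: seqs_def emitting_Skip)
next
  case (Cons x xs)
  have "emitting Z (Seq (P x) (seqs (map P xs))) (\<lambda>w m. s x w m @ concat (map (\<lambda>x. s x w m) xs))"
    by (rule emitting_Seq) (use Cons in auto)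
  then show ?case by (simp add: seqs_def)
qed

definition emit_bits :: "bool list \<Rightarrow> com" where
  "emit_bits bs = seqs (map Emit bs)"

lemma emitting_emit_bits: "emitting Z (emit_bits bs) (\<lambda>w m. bs)"
  using emitting_seqs[of bs Z Emit "\<lambda>b w m. [b]"] emitting_Emit by (simp add: emit_bits_def)

definition same :: "nat \<Rightarrow> nat \<Rightarrow> com \<Rightarrow> com \<Rightarrow> com" where
  "same k j P Q = At k Stay (\<lambda>a. a ! j = 1) P Q"

lemma emitting_same:
  assumes "k \<in> {1..<5}" "j \<in> {1..<5}" "emitting Z P s" "emitting Z Q t"
  shows "emitting Z (same k j P Q) (\<lambda>w m. if m k = m j then s w m else t w m)"
  unfolding same_def
  by (rule emitting_cong[OF emitting_At[OF assms(1) _ assms(3,4)]])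
    (use assms(2) in \<open>auto simp: mark_tapes_def\<close>)

text \<open>Kind 1: both are the right end marker; kinds 2, 3, 4: \<open>q\<close> is the successor of \<open>p\<close>, and \<open>p\<close> is
  the left end marker, a letter \<open>False\<close>, a letter \<open>True\<close>; kind 0: none of these.\<close>

definition pair_kind :: "bool list \<Rightarrow> nat \<Rightarrow> nat \<Rightarrow> nat" where
  "pair_kind w p q =
     (if p = q then (if p = length w + 1 then 1 else 0)
      else if q = p + 1 then (if p = 0 then 2 else if w ! (p - 1) then 4 else 3)
      else 0)"

text \<open>Counters 1 and 2 hold \<open>p\<close> and \<open>q\<close>. Reading tape 2 one cell to
  the right of mark 1 decides whether \<open>q\<close> is the successor of \<open>p\<close>; the
  other tests read the input symbol at \<open>p\<close>.\<close>

definition by_kind :: "(nat \<Rightarrow> com) \<Rightarrow> com" where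
  "by_kind P = same 1 2 (At 1 Stay (\<lambda>a. a ! 0 = 4) (P 1) (P 0))
     (At 1 Right (\<lambda>a. a ! 2 = 1)
        (At 1 Stay (\<lambda>a. a ! 0 = 3) (P 2) (At 1 Stay (\<lambda>a. a ! 0 = 2) (P 4) (P 3))) (P 0))"

lemma emitting_by_kind:
  assumes "\<And>i. i < 5 \<Longrightarrow> emitting Z (P i) (s i)"
  shows "emitting Z (by_kind P) (\<lambda>w m. s (pair_kind w (m 1) (m 2)) w m)"
proof -
  have P: "emitting Z (P 0) (s 0)" "emitting Z (P 1) (s 1)" "emitting Z (P 2) (s 2)"
    "emitting Z (P 3) (s 3)" "emitting Z (P 4) (s 4)"
    by (rule assms, simp)+
  have 1: "(1::nat) \<in> {1..<5}" "(2::nat) \<in> {1..<5}" by simp_all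
  have d: "Stay \<noteq> Left" "Right \<noteq> Left" by simp_all
  note at = emitting_At[OF 1(1)]
  show ?thesis
    unfolding by_kind_def
  proof (rule emitting_cong[OF emitting_same[OF 1 at[OF d(1) P(2,1)]
        at[OF d(2) at[OF d(1) P(3) at[OF d(1) P(5,4)]] P(1)]]], goal_cases)
    case (1 w m)
    have lt: "m 1 < length w + 2" "m 2 < length w + 2"
      using 1 by auto
    have nxt: "scanned (mark_tapes w m) (shift Right (int (m 1) - 1)) ! 2 = 1 \<longleftrightarrow> m 2 = m 1 + 1"
      by (auto simp: mark_tapes_def)
    have here: "scanned (mark_tapes w m) (shift Stay (int (m 1) - 1)) ! 0 = word_tape w (int (m 1) - 1)"
      by (simp add: mark_tapes_def)
    have w2: "word_tape w (int (m 1) - 1) = 2 \<longleftrightarrow> w ! (m 1 - 1)" if "m 1 \<noteq> 0" "m 1 \<noteq> length w + 1"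
      using that lt by (auto simp: word_tape_def tape_content_def nat_diff_distrib)
    show ?case
      unfolding nxt here word_tape_eq_3_iff word_tape_eq_4_iff
      using lt w2 by (auto simp: pair_kind_def)
  qed
qed

context
  fixes K :: nat
begin

text \<open>An exponent list \<open>e\<close> of length \<open>3 * K\<close> refers to the \<open>K\<close> variables of the pair \<open>(p, p)\<close>, then to
  those of \<open>(q, q)\<close>, then to those of \<open>(p, q)\<close>. For \<open>p = q\<close> these coincide, so the exponents add up.\<close>

definition exponent :: "nat list \<Rightarrow> nat \<Rightarrow> nat \<Rightarrow> nat \<Rightarrow> nat \<Rightarrow> nat \<Rightarrow> nat" where
  "exponent e p q s t k =
     (if s = p \<and> t = p then e ! k else 0) + (if s = q \<and> t = q then e ! (K + k) else 0) +
     (if s = p \<and> t = q then e ! (2 * K + k) else 0)"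

text \<open>The order of the exponents is that in which nested loops over counters 3 and 4 visit the
  pairs, and it agrees with the numbering of variables in \<open>cell\<close>.\<close>

definition spread :: "nat \<Rightarrow> nat \<Rightarrow> nat \<Rightarrow> nat list \<Rightarrow> nat list" where
  "spread N p q e = concat (map (\<lambda>s. concat (map (\<lambda>t. map (exponent e p q s t) [0..<K]) [0..<N])) [0..<N])"

definition spread_poly :: "nat \<Rightarrow> nat \<Rightarrow> nat \<Rightarrow> int_poly \<Rightarrow> int_poly" where
  "spread_poly N p q P = map (\<lambda>(c, e). (c, spread N p q e)) P"

definition if_marks :: "nat \<Rightarrow> nat \<Rightarrow> com \<Rightarrow> com" where
  "if_marks i j P = same 3 i (same 4 j P Skip) Skip"

text \<open>Since exponents are unary, the sum of the three contributions is written by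
  concatenating blocks of ones, and the machine never has to add. The leading \<open>True\<close> is
  the list constructor in the encoding.\<close>

definition emit_exponent :: "nat list \<Rightarrow> nat \<Rightarrow> com" where
  "emit_exponent e k = Seq (Emit True) (Seq (if_marks 1 1 (emit_bits (replicate (e ! k) True)))
     (Seq (if_marks 2 2 (emit_bits (replicate (e ! (K + k)) True)))
     (Seq (if_marks 1 2 (emit_bits (replicate (e ! (2 * K + k)) True))) (Emit False))))"

definition emit_term :: "int \<times> nat list \<Rightarrow> com" where
  "emit_term ce = Seq (emit_bits (True # enc_int (fst ce)))
     (Seq (For 3 (For 4 (seqs (map (emit_exponent (snd ce)) [0..<K])))) (Emit False))"

lemma emitting_if_marks:
  assumes "i \<in> {1..<5}" "j \<in> {1..<5}" "emitting Z P s"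
  shows "emitting Z (if_marks i j P) (\<lambda>w m. if m 3 = m i then if m 4 = m j then s w m else [] else [])"
  unfolding if_marks_def by (intro emitting_same assms emitting_Skip) simp_all

lemma emitting_emit_exponent:
  "emitting Z (emit_exponent e k) (\<lambda>w m. True # enc_unary (exponent e (m 1) (m 2) (m 3) (m 4) k))"
  unfolding emit_exponent_def
  by (rule emitting_cong, (rule emitting_Seq emitting_Emit emitting_if_marks emitting_emit_bits | simp)+)
    (auto simp: exponent_def enc_unary_def replicate_add)

lemma concat_concat: "concat (concat xss) = concat (map concat xss)"
  by (induction xss) auto

lemma emitting_emit_term:
  assumes "{3, 4} \<subseteq> Z"
  shows "emitting Z (emit_term ce) (\<lambda>w m. True # enc_term (fst ce, spread (framed_length w) (m 1) (m 2) (snd ce)))"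
proof -
  have l: "emitting Z (For 3 (For 4 (seqs (map (emit_exponent (snd ce)) [0..<K]))))
     (\<lambda>w m. concat (map (\<lambda>s. concat (map (\<lambda>t. concat (map (\<lambda>k.
        True # enc_unary (exponent (snd ce) (m 1) (m 2) s t k)) [0..<K])) [0..<framed_length w])) [0..<framed_length w]))"
    by (rule emitting_cong, rule emitting_For, simp, use assms in simp, rule emitting_For, simp,
       use assms in simp, rule emitting_seqs, rule emitting_emit_exponent) simp
  show ?thesis
    unfolding emit_term_def
    by (rule emitting_cong, rule emitting_Seq, rule emitting_emit_bits, rule emitting_Seq, rule l, rule emitting_Emit)
      (simp add: enc_term_def enc_list_def spread_def map_concat comp_def concat_concat del: upt_Suc)
qed

text \<open>The parts of the output are the dimension in unary, the constant term 1, the terms of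
  all pairs, the end of the list of terms, and the threshold \<open>1 / 1\<close>.\<close>

definition generator :: "(nat \<Rightarrow> int_poly) \<Rightarrow> com" where
  "generator T = Seq (For 3 (For 4 (emit_bits (replicate K True)))) (Seq (Emit False)
     (Seq (emit_term (1, replicate (3 * K) 0))
     (Seq (For 1 (For 2 (by_kind (\<lambda>i. seqs (map emit_term (T i)))))) (Seq (Emit False)
     (emit_bits (enc_int 1 @ enc_int 1))))))"

definition generated :: "(nat \<Rightarrow> int_poly) \<Rightarrow> bool list \<Rightarrow> int_poly" where
  "generated T w = (1, spread (framed_length w) 0 0 (replicate (3 * K) 0)) #
     concat (map (\<lambda>p. concat (map (\<lambda>q. spread_poly (framed_length w) p q (T (pair_kind w p q)))
       [0..<framed_length w])) [0..<framed_length w])"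

lemma concat_replicate_upt: "concat (map (\<lambda>s. replicate n x) [0..<a]) = replicate (a * n) x"
  by (induction a) (auto simp: replicate_add[symmetric] add.commute)

lemma polytime_computable_generated:
  "polytime_computable (\<lambda>w. enc_HD_instance (framed_length w * (framed_length w * K)) (generated T w) 1 1)"
proof -
  have 1: "emitting UNIV (For 3 (For 4 (emit_bits (replicate K True))))
     (\<lambda>w m. replicate (framed_length w * (framed_length w * K)) True)"
    by (rule emitting_cong, rule emitting_For, simp, simp, rule emitting_For, simp, simp, rule emitting_emit_bits)
      (simp only: concat_replicate_upt)
  have 2: "emitting UNIV (For 1 (For 2 (by_kind (\<lambda>i. seqs (map emit_term (T i))))))
    (\<lambda>w m. concat (map (\<lambda>p. concat (map (\<lambda>q. concat (map (\<lambda>ce.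
       True # enc_term (fst ce, spread (framed_length w) p q (snd ce))) (T (pair_kind w p q)))) [0..<framed_length w])) [0..<framed_length w]))"
    by (rule emitting_cong, rule emitting_For, simp, simp, rule emitting_For, simp, simp, rule emitting_by_kind,
        rule emitting_seqs, rule emitting_emit_term) simp_all
  have "emitting UNIV (generator T) (\<lambda>w m. enc_unary (framed_length w * (framed_length w * K)) @
      (True # enc_term (1, spread (framed_length w) (m 1) (m 2) (replicate (3 * K) 0))) @
      concat (map (\<lambda>p. concat (map (\<lambda>q. concat (map (\<lambda>ce.
       True # enc_term (fst ce, spread (framed_length w) p q (snd ce))) (T (pair_kind w p q)))) [0..<framed_length w])) [0..<framed_length w])
      @ [False] @ enc_int 1 @ enc_int 1)"
    unfolding generator_def
    by (rule emitting_cong, (rule emitting_Seq 1 2 emitting_Emit emitting_emit_term emitting_emit_bits | simp)+)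
      (simp add: enc_unary_def)
  from polytime_computable_if_emitting[OF this]
  show ?thesis
    by (simp add: enc_HD_instance_def generated_def enc_poly_def enc_list_def spread_poly_def map_concat
        comp_def case_prod_unfold concat_concat del: upt_Suc)
qed

end

section \<open>Evaluation of the produced polynomial\<close>

lemma prod_lessThan_add:
  fixes f :: "nat \<Rightarrow> real"
  shows "(\<Prod>i<m + n. f i) = (\<Prod>i<m. f i) * (\<Prod>i<n. f (m + i))"
  by (induction n) (simp_all add: mult.assoc)

lemma length_concat_upt:
  "(\<And>s. length (f s) = b) \<Longrightarrow> length (concat (map f [0..<a])) = a * b"
  by (induction a) (auto simp: add.commute)

lemma prod_concat_upt:
  fixes g :: "nat \<Rightarrow> nat \<Rightarrow> real"
  assumes len: "\<And>s. length (f s) = b"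
  shows "(\<Prod>i<a * b. g i (concat (map f [0..<a]) ! i)) = (\<Prod>s<a. \<Prod>i<b. g (s * b + i) (f s ! i))"
proof (induction a)
  case (Suc a)
  let ?l = "concat (map f [0..<a])"
  have l: "length ?l = a * b"
    by (rule length_concat_upt[OF len])
  have "(\<Prod>i<a * b + b. g i ((?l @ f a) ! i)) =
      (\<Prod>i<a * b. g i ((?l @ f a) ! i)) * (\<Prod>i<b. g (a * b + i) ((?l @ f a) ! (a * b + i)))"
    by (rule prod_lessThan_add)
  also have "\<dots> = (\<Prod>i<a * b. g i (?l ! i)) * (\<Prod>i<b. g (a * b + i) (f a ! i))"
    by (intro arg_cong2[of _ _ _ _ "(*)"] prod.cong) (auto simp: nth_append l)
  finally show ?case
    using Suc.IH by (simp add: add.commute)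
qed simp

context
  fixes K :: nat
begin

definition cell :: "nat \<Rightarrow> (nat \<Rightarrow> real) \<Rightarrow> nat \<Rightarrow> nat \<Rightarrow> nat \<Rightarrow> real" where
  "cell N x s t k = x ((s * N + t) * K + k)"

text \<open>The blocks come in the same order as in an exponent list of length \<open>3 * K\<close>.
  Spreading exponents over all variables thereby becomes substituting this view.\<close>

definition local_view :: "nat \<Rightarrow> (nat \<Rightarrow> real) \<Rightarrow> nat \<Rightarrow> nat \<Rightarrow> nat \<Rightarrow> real" where
  "local_view N x p q j = (if j < K then cell N x p p j else if j < 2 * K then cell N x q q (j - K)
     else cell N x p q (j - 2 * K))"

lemma length_spread: "length (spread K N p q e) = N * (N * K)"
  unfolding spread_def by (intro length_concat_upt) (simp add: length_concat_upt)

lemma prod_delta2: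
  fixes f :: "nat \<Rightarrow> nat \<Rightarrow> real"
  assumes "p < N" "q < N"
  shows "(\<Prod>s<N. \<Prod>t<N. if s = p \<and> t = q then f s t else 1) = f p q"
proof -
  have "(\<Prod>t<N. if s = p \<and> t = q then f s t else 1) = (if s = p then f p q else 1)" for s
    using assms by (cases "s = p") simp_all
  then show ?thesis
    using assms by simp
qed

lemma prod_cells:
  fixes X :: "nat \<Rightarrow> nat \<Rightarrow> nat \<Rightarrow> real"
  assumes "p < N" "q < N"
  shows "(\<Prod>s<N. \<Prod>t<N. \<Prod>k<K. X s t k ^ (if s = p \<and> t = q then e k else 0)) =
     (\<Prod>k<K. X p q k ^ e k)"
proof -
  have "(\<Prod>k<K. X s t k ^ (if s = p \<and> t = q then e k else 0)) =
      (if s = p \<and> t = q then \<Prod>k<K. X s t k ^ e k else 1)" for s t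
    by auto
  then show ?thesis
    using prod_delta2[OF assms, of "\<lambda>s t. \<Prod>k<K. X s t k ^ e k"] by simp
qed

text \<open>Exponents add up, so each power splits into three factors, each of which is nontrivial
  at a single pair only. This covers the case \<open>p = q\<close> without a case
  distinction.\<close>

lemma prod_spread:
  assumes "p < N" "q < N"
  shows "(\<Prod>i<length (spread K N p q e). x i ^ (spread K N p q e ! i)) =
    (\<Prod>i<3 * K. local_view N x p q i ^ (e ! i))"
proof -
  let ?X = "cell N x"
  have inner: "length (concat (map (\<lambda>t. map (exponent K e p q s t) [0..<K]) [0..<N])) = N * K" for s
    by (simp add: length_concat_upt)
  have "(\<Prod>i<length (spread K N p q e). x i ^ (spread K N p q e ! i)) =
     (\<Prod>s<N. \<Prod>i<N * K. x (s * (N * K) + i) ^ (concat (map (\<lambda>t. map (exponent K e p q s t) [0..<K]) [0..<N]) ! i))"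
    unfolding length_spread unfolding spread_def
    by (rule prod_concat_upt[where g = "\<lambda>i n. x i ^ n", OF inner])
  also have "\<dots> = (\<Prod>s<N. \<Prod>t<N. \<Prod>k<K. x (s * (N * K) + (t * K + k)) ^ exponent K e p q s t k)"
  proof (rule prod.cong[OF refl])
    fix s
    show "(\<Prod>i<N * K. x (s * (N * K) + i) ^ (concat (map (\<lambda>t. map (exponent K e p q s t) [0..<K]) [0..<N]) ! i)) =
      (\<Prod>t<N. \<Prod>k<K. x (s * (N * K) + (t * K + k)) ^ exponent K e p q s t k)"
      using prod_concat_upt[where g = "\<lambda>i n. x (s * (N * K) + i) ^ n"
          and f = "\<lambda>t. map (exponent K e p q s t) [0..<K]" and a = N and b = K] by simp
  qed
  also have "\<dots> = (\<Prod>s<N. \<Prod>t<N. \<Prod>k<K. ?X s t k ^ exponent K e p q s t k)"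
    by (simp add: cell_def algebra_simps)
  also have "\<dots> = (\<Prod>k<K. ?X p p k ^ (e ! k)) * (\<Prod>k<K. ?X q q k ^ (e ! (K + k))) *
      (\<Prod>k<K. ?X p q k ^ (e ! (2 * K + k)))"
    unfolding exponent_def power_add prod.distrib using assms by (simp add: prod_cells)
  also have "\<dots> = (\<Prod>i<K + K + K. local_view N x p q i ^ (e ! i))"
    unfolding prod_lessThan_add by (simp add: local_view_def mult_2 add.assoc)
  finally show ?thesis
    by (simp add: numeral_3_eq_3 add.assoc)
qed

lemma eval_spread_poly:
  assumes "p < N" "q < N" "is_poly (3 * K) P"
  shows "eval_poly (spread_poly K N p q P) x = eval_poly P (local_view N x p q)"
  using assms(3)
proof (induction P)
  case (Cons ce P)
  obtain c e where ce: "ce = (c, e)" by (cases ce)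
  with Cons.prems have e: "length e = 3 * K" and P: "is_poly (3 * K) P"
    by (auto simp: is_poly_def)
  have "(\<Prod>i<length (spread K N p q e). x i ^ (spread K N p q e ! i)) =
      (\<Prod>i<length e. local_view N x p q i ^ (e ! i))"
    unfolding e by (rule prod_spread[OF assms(1,2)])
  with Cons.IH[OF P] show ?case
    by (simp add: spread_poly_def eval_poly_def ce)
qed (simp add: spread_poly_def eval_poly_def)

lemma eval_poly_append: "eval_poly (p @ q) x = eval_poly p x + eval_poly q x"
  by (simp add: eval_poly_def)

lemma eval_poly_concat_upt: "eval_poly (concat (map f [0..<n])) x = (\<Sum>i<n. eval_poly (f i) x)"
  by (induction n) (simp_all add: eval_poly_append, simp add: eval_poly_def)

lemma eval_generated:
  assumes "\<And>i. is_poly (3 * K) (T i)"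
  shows "eval_poly (generated K T w) x =
    1 + (\<Sum>p<framed_length w. \<Sum>q<framed_length w. eval_poly (T (pair_kind w p q)) (local_view (framed_length w) x p q))"
proof -
  let ?N = "framed_length w"
  have "eval_poly [(1, spread K ?N 0 0 (replicate (3 * K) 0))] x =
     eval_poly [(1, replicate (3 * K) 0)] (local_view ?N x 0 0)"
    using eval_spread_poly[of 0 ?N 0 "[(1, replicate (3 * K) 0)]" x]
    by (simp add: is_poly_def spread_poly_def)
  also have "\<dots> = 1"
    by (simp add: eval_poly_def)
  finally have c: "eval_poly [(1, spread K ?N 0 0 (replicate (3 * K) 0))] x = 1" .
  have "eval_poly (generated K T w) x = eval_poly [(1, spread K ?N 0 0 (replicate (3 * K) 0))] x +
     (\<Sum>p<?N. \<Sum>q<?N. eval_poly (spread_poly K ?N p q (T (pair_kind w p q))) x)"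
    unfolding generated_def eval_poly_concat_upt[symmetric] eval_poly_append[symmetric] by simp
  also have "(\<Sum>p<?N. \<Sum>q<?N. eval_poly (spread_poly K ?N p q (T (pair_kind w p q))) x) =
     (\<Sum>p<?N. \<Sum>q<?N. eval_poly (T (pair_kind w p q)) (local_view ?N x p q))"
    by (intro sum.cong refl eval_spread_poly assms) auto
  finally show ?thesis
    unfolding c .
qed

lemma is_poly_generated: "is_poly (framed_length w * (framed_length w * K)) (generated K T w)"
  by (auto simp: is_poly_def generated_def spread_poly_def length_spread simp del: upt_Suc)

end

section \<open>Projections of real zero sets\<close>

text \<open>Integer polynomials are treated as functions, so that membership follows by introduction
  rules; the translation to lists of terms happens only in
  \<open>polyfun_imp_int_poly\<close>.\<close>

inductive polyfun :: "nat \<Rightarrow> ((nat \<Rightarrow> real) \<Rightarrow> real) \<Rightarrow> bool" for n where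
  const: "polyfun n (\<lambda>x. of_int c)"
| var: "i < n \<Longrightarrow> polyfun n (\<lambda>x. x i)"
| add: "polyfun n f \<Longrightarrow> polyfun n g \<Longrightarrow> polyfun n (\<lambda>x. f x + g x)"
| mult: "polyfun n f \<Longrightarrow> polyfun n g \<Longrightarrow> polyfun n (\<lambda>x. f x * g x)"

lemma polyfun_numeral: "polyfun n (\<lambda>x. numeral k)" "polyfun n (\<lambda>x. 0)" "polyfun n (\<lambda>x. 1)"
  using polyfun.const[of n "numeral k"] polyfun.const[of n 0] polyfun.const[of n 1] by simp_all

lemma polyfun_diff: "polyfun n f \<Longrightarrow> polyfun n g \<Longrightarrow> polyfun n (\<lambda>x. f x - g x)"
  using polyfun.add[OF _ polyfun.mult[OF polyfun.const[of n "-1"]], of f g] by simp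

lemma polyfun_power: "polyfun n f \<Longrightarrow> polyfun n (\<lambda>x. f x ^ k)"
  by (induction k) (simp_all add: polyfun_numeral polyfun.mult)

lemma polyfun_uminus: "polyfun n f \<Longrightarrow> polyfun n (\<lambda>x. - f x)"
  using polyfun_diff[OF polyfun_numeral(2), of n f] by simp

lemmas polyfun_intros = polyfun.var polyfun_numeral polyfun.add polyfun.mult polyfun_diff
  polyfun_power polyfun_uminus

lemma polyfun_rename:
  assumes "polyfun n f" "\<And>i. i < n \<Longrightarrow> \<rho> i < m"
  shows "polyfun m (\<lambda>x. f (\<lambda>i. x (\<rho> i)))"
  using assms(1) by induction (auto intro: polyfun.intros assms(2))

lemma polyfun_cong:
  assumes "polyfun n f" "\<And>i. i < n \<Longrightarrow> x i = y i"
  shows "f x = f y"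
  using assms(1) by induction (simp_all add: assms(2))

lemma polyfun_mono: "polyfun n f \<Longrightarrow> n \<le> m \<Longrightarrow> polyfun m f"
  using polyfun_rename[of n f "\<lambda>i. i" m] by simp

definition poly_mult :: "int_poly \<Rightarrow> int_poly \<Rightarrow> int_poly" where
  "poly_mult P Q = concat (map (\<lambda>(c, e). map (\<lambda>(c', e'). (c * c', map2 (+) e e')) Q) P)"

lemma eval_poly_mult:
  assumes "is_poly n P" "is_poly n Q"
  shows "eval_poly (poly_mult P Q) x = eval_poly P x * eval_poly Q x" "is_poly n (poly_mult P Q)"
proof -
  have scaled: "eval_poly (map (\<lambda>(c', e'). (c * c', map2 (+) e e')) Q) x =
      of_int c * (\<Prod>i<n. x i ^ (e ! i)) * eval_poly Q x" if e: "length e = n" for c e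
    using assms(2)
  proof (induction Q)
    case (Cons t Q)
    obtain c' e' where t: "t = (c', e')" by (cases t)
    with Cons.prems have e': "length e' = n" and "is_poly n Q"
      by (auto simp: is_poly_def)
    have "(\<Prod>i<n. x i ^ (map2 (+) e e' ! i)) = (\<Prod>i<n. x i ^ (e ! i)) * (\<Prod>i<n. x i ^ (e' ! i))"
      unfolding prod.distrib[symmetric] using e e' by (intro prod.cong) (simp_all add: power_add)
    with Cons.IH[OF \<open>is_poly n Q\<close>] show ?case
      using e e' by (simp add: eval_poly_def t algebra_simps)
  qed (simp add: eval_poly_def)
  show "eval_poly (poly_mult P Q) x = eval_poly P x * eval_poly Q x"
    using assms(1)
  proof (induction P)
    case (Cons t P)
    obtain c e where t: "t = (c, e)" by (cases t)
    with Cons.prems have e: "length e = n" and "is_poly n P"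
      by (auto simp: is_poly_def)
    from Cons.IH[OF this(2)] scaled[OF e, of c] show ?case
      by (simp add: poly_mult_def eval_poly_def t e algebra_simps)
  qed (simp add: eval_poly_def poly_mult_def)
  show "is_poly n (poly_mult P Q)"
    using assms by (fastforce simp: is_poly_def poly_mult_def)
qed

text \<open>Because a monomial may occur in several terms, addition is concatenation and products
  need no normalisation.\<close>

lemma polyfun_imp_int_poly:
  assumes "polyfun n f"
  shows "\<exists>P. is_poly n P \<and> (\<forall>x. eval_poly P x = f x)"
  using assms
proof induction
  case (const c)
  show ?case
    by (rule exI[of _ "[(c, replicate n 0)]"]) (simp add: is_poly_def eval_poly_def)
next
  case (var i)
  have "(\<Prod>j<n. x j ^ ((replicate n 0)[i := 1] ! j)) = (\<Prod>j<n. if j = i then x j else 1)" for x :: "nat \<Rightarrow> real"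
    by (intro prod.cong) (auto simp: nth_list_update)
  with var show ?case
    by (intro exI[of _ "[(1, (replicate n 0)[i := 1])]"]) (simp add: is_poly_def eval_poly_def)
next
  case (add f g)
  then obtain P Q where PQ: "is_poly n P" "\<forall>x. eval_poly P x = f x" "is_poly n Q" "\<forall>x. eval_poly Q x = g x"
    by (elim exE conjE)
  show ?case
  proof (intro exI conjI allI)
    show "is_poly n (P @ Q)"
      using PQ(1,3) by (auto simp: is_poly_def)
    show "eval_poly (P @ Q) x = f x + g x" for x
      using PQ(2,4) by (simp add: eval_poly_def)
  qed
next
  case (mult f g)
  then obtain P Q where PQ: "is_poly n P" "\<forall>x. eval_poly P x = f x" "is_poly n Q" "\<forall>x. eval_poly Q x = g x"
    by (elim exE conjE)
  show ?case
  proof (intro exI conjI allI)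
    show "is_poly n (poly_mult P Q)"
      by (rule eval_poly_mult(2)[OF PQ(1,3)])
    show "eval_poly (poly_mult P Q) x = f x * g x" for x
      using PQ(2,4) by (simp add: eval_poly_mult(1)[OF PQ(1,3)])
  qed
qed

text \<open>\<open>R\<close> is the projection to the first \<open>m\<close> coordinates of a real
  zero set; the coordinates from \<open>m\<close> on are slack variables. Negation is avoided by
  having a rule for each of the comparisons that occur.\<close>

definition definable :: "nat \<Rightarrow> ((nat \<Rightarrow> real) \<Rightarrow> bool) \<Rightarrow> bool" where
  "definable m R \<longleftrightarrow> (\<exists>n f. m \<le> n \<and> polyfun n f \<and>
     (\<forall>v. R v \<longleftrightarrow> (\<exists>v'. (\<forall>i<m. v' i = v i) \<and> f v' = 0)))"

lemma definable_one_slack: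
  assumes f: "polyfun (Suc m) f" and R: "\<And>v. R v \<longleftrightarrow> (\<exists>y. f (v(m := y)) = 0)"
  shows "definable m R"
proof -
  have "R v \<longleftrightarrow> (\<exists>v'. (\<forall>i<m. v' i = v i) \<and> f v' = 0)" for v
  proof
    assume "R v"
    then obtain y where "f (v(m := y)) = 0"
      using R by blast
    then show "\<exists>v'. (\<forall>i<m. v' i = v i) \<and> f v' = 0"
      by (intro exI[of _ "v(m := y)"]) auto
  next
    assume "\<exists>v'. (\<forall>i<m. v' i = v i) \<and> f v' = 0"
    then obtain v' where "\<forall>i<m. v' i = v i" "f v' = 0" by blast
    moreover from this have "f v' = f (v(m := v' m))"
      by (intro polyfun_cong[OF f]) (auto simp: less_Suc_eq)
    ultimately show "R v"
      unfolding R by (intro exI[of _ "v' m"]) simp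
  qed
  then show ?thesis
    unfolding definable_def using f by (intro exI[of _ "Suc m"] exI[of _ f]) simp
qed

lemma polyfun_upd: "polyfun m f \<Longrightarrow> f (v(m := y)) = f v"
  by (rule polyfun_cong) auto

lemma definable_eq:
  assumes "polyfun m f" "polyfun m g"
  shows "definable m (\<lambda>v. f v = g v)"
proof (rule definable_one_slack)
  show "polyfun (Suc m) (\<lambda>v. f v - g v)"
    by (intro polyfun_diff polyfun_mono[OF assms(1)] polyfun_mono[OF assms(2)]) simp_all
qed (simp add: polyfun_upd[OF assms(1)] polyfun_upd[OF assms(2)])

lemma definable_le:
  assumes "polyfun m f" "polyfun m g"
  shows "definable m (\<lambda>v. f v \<le> g v)"
proof (rule definable_one_slack)
  show "polyfun (Suc m) (\<lambda>v. g v - f v - (v m)\<^sup>2)"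
    by (intro polyfun_intros polyfun_mono[OF assms(1)] polyfun_mono[OF assms(2)]) simp_all
  show "f v \<le> g v \<longleftrightarrow> (\<exists>y. g (v(m := y)) - f (v(m := y)) - ((v(m := y)) m)\<^sup>2 = 0)" for v
  proof
    assume "f v \<le> g v"
    then show "\<exists>y. g (v(m := y)) - f (v(m := y)) - ((v(m := y)) m)\<^sup>2 = 0"
      by (intro exI[of _ "sqrt (g v - f v)"]) (simp add: polyfun_upd[OF assms(1)] polyfun_upd[OF assms(2)])
  next
    assume "\<exists>y. g (v(m := y)) - f (v(m := y)) - ((v(m := y)) m)\<^sup>2 = 0"
    then obtain y where "g v - f v = y\<^sup>2"
      by (auto simp: polyfun_upd[OF assms(1)] polyfun_upd[OF assms(2)])
    then show "f v \<le> g v"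
      using zero_le_power2[of y] by linarith
  qed
qed

text \<open>A real number is positive exactly if some square is its reciprocal.\<close>

lemma definable_less:
  assumes "polyfun m f" "polyfun m g"
  shows "definable m (\<lambda>v. f v < g v)"
proof (rule definable_one_slack)
  show "polyfun (Suc m) (\<lambda>v. (g v - f v) * (v m)\<^sup>2 - 1)"
    by (intro polyfun_intros polyfun_mono[OF assms(1)] polyfun_mono[OF assms(2)]) simp_all
  show "f v < g v \<longleftrightarrow> (\<exists>y. (g (v(m := y)) - f (v(m := y))) * ((v(m := y)) m)\<^sup>2 - 1 = 0)" for v
  proof
    assume "f v < g v"
    then show "\<exists>y. (g (v(m := y)) - f (v(m := y))) * ((v(m := y)) m)\<^sup>2 - 1 = 0"
      by (intro exI[of _ "sqrt (1 / (g v - f v))"]) (simp add: polyfun_upd[OF assms(1)] polyfun_upd[OF assms(2)])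
  next
    assume "\<exists>y. (g (v(m := y)) - f (v(m := y))) * ((v(m := y)) m)\<^sup>2 - 1 = 0"
    then obtain y where "(g v - f v) * y\<^sup>2 = 1"
      by (auto simp: polyfun_upd[OF assms(1)] polyfun_upd[OF assms(2)])
    then have "0 < (g v - f v) * y\<^sup>2" by simp
    then show "f v < g v"
      by (auto simp: zero_less_mult_iff)
  qed
qed

lemma definable_neq:
  assumes "polyfun m f" "polyfun m g"
  shows "definable m (\<lambda>v. f v \<noteq> g v)"
proof (rule definable_one_slack)
  show "polyfun (Suc m) (\<lambda>v. (g v - f v) * v m - 1)"
    by (intro polyfun_intros polyfun_mono[OF assms(1)] polyfun_mono[OF assms(2)]) simp_all
  show "f v \<noteq> g v \<longleftrightarrow> (\<exists>y. (g (v(m := y)) - f (v(m := y))) * (v(m := y)) m - 1 = 0)" for v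
    by (auto simp: polyfun_upd[OF assms(1)] polyfun_upd[OF assms(2)] intro!: exI[of _ "1 / (g v - f v)"])
qed

text \<open>A product vanishes as soon as one factor does, so the two relations may share their
  slack variables.\<close>

lemma definable_disj:
  assumes "definable m R" "definable m S"
  shows "definable m (\<lambda>v. R v \<or> S v)"
proof -
  from assms obtain n1 f1 n2 f2 where
    1: "m \<le> n1" "polyfun n1 f1" "\<forall>v. R v \<longleftrightarrow> (\<exists>v'. (\<forall>i<m. v' i = v i) \<and> f1 v' = 0)" and
    2: "m \<le> n2" "polyfun n2 f2" "\<forall>v. S v \<longleftrightarrow> (\<exists>v'. (\<forall>i<m. v' i = v i) \<and> f2 v' = 0)"
    unfolding definable_def by blast
  have "polyfun (max n1 n2) (\<lambda>v. f1 v * f2 v)"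
    using polyfun_mono[OF 1(2)] polyfun_mono[OF 2(2)] by (intro polyfun.mult) simp_all
  then show ?thesis
    unfolding definable_def
    by (intro exI[of _ "max n1 n2"] exI[of _ "\<lambda>v. f1 v * f2 v"])
      (simp add: 1(1,3) 2(1,3) le_max_iff_disj conj_disj_distribL ex_disj_distrib)
qed

lemma definable_conj:
  assumes "definable m R" "definable m S"
  shows "definable m (\<lambda>v. R v \<and> S v)"
proof -
  from assms obtain n1 f1 n2 f2 where
    1: "m \<le> n1" "polyfun n1 f1" "\<forall>v. R v \<longleftrightarrow> (\<exists>v'. (\<forall>i<m. v' i = v i) \<and> f1 v' = 0)" and
    2: "m \<le> n2" "polyfun n2 f2" "\<forall>v. S v \<longleftrightarrow> (\<exists>v'. (\<forall>i<m. v' i = v i) \<and> f2 v' = 0)"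
    unfolding definable_def by blast
  \<comment> \<open>In a conjunction both sets of slack variables are in use at once, so those of
    the second relation are moved beyond \<open>n1\<close>.\<close>
  define \<rho> where "\<rho> i = (if i < m then i else n1 + i)" for i
  let ?f = "\<lambda>v. (f1 v)\<^sup>2 + (f2 (\<lambda>i. v (\<rho> i)))\<^sup>2"
  have "polyfun (n1 + n2) ?f"
    by (intro polyfun_intros polyfun_mono[OF 1(2)] polyfun_rename[OF 2(2)])
      (use 1(1) 2(1) in \<open>auto simp: \<rho>_def\<close>)
  moreover have "R v \<and> S v \<longleftrightarrow> (\<exists>v'. (\<forall>i<m. v' i = v i) \<and> ?f v' = 0)" for v
  proof
    assume "R v \<and> S v"
    then obtain v1 v2 where v1: "\<forall>i<m. v1 i = v i" "f1 v1 = 0" and v2: "\<forall>i<m. v2 i = v i" "f2 v2 = 0"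
      using 1(3) 2(3) by blast
    define v' where "v' i = (if i < n1 then v1 i else v2 (i - n1))" for i
    have "f1 v' = f1 v1"
      by (rule polyfun_cong[OF 1(2)]) (simp add: v'_def)
    moreover have "(\<lambda>i. v' (\<rho> i)) = v2"
      using 1(1) v1(1) v2(1) by (auto simp: v'_def \<rho>_def fun_eq_iff)
    ultimately show "\<exists>v'. (\<forall>i<m. v' i = v i) \<and> ?f v' = 0"
      using v1 v2 1(1) by (intro exI[of _ v']) (simp add: v'_def)
  next
    assume "\<exists>v'. (\<forall>i<m. v' i = v i) \<and> ?f v' = 0"
    then obtain v' where v': "\<forall>i<m. v' i = v i" "f1 v' = 0" "f2 (\<lambda>i. v' (\<rho> i)) = 0"
      by (auto simp: sum_power2_eq_zero_iff)
    moreover from v'(1) have "\<forall>i<m. v' (\<rho> i) = v i"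
      by (simp add: \<rho>_def)
    ultimately show "R v \<and> S v"
      unfolding 1(3)[rule_format, of v] 2(3)[rule_format, of v]
      by (intro conjI[OF exI[of _ v'] exI[of _ "\<lambda>i. v' (\<rho> i)"]]) simp_all
  qed
  ultimately show ?thesis
    unfolding definable_def using 1(1)
    by (intro exI[of _ "n1 + n2"] exI[of _ ?f]) simp
qed

lemmas definable_intros = definable_eq definable_le definable_less definable_neq definable_disj
  definable_conj

section \<open>A real register automaton for the existential theory of the reals\<close>

text \<open>The register \<open>ctr\<close> counts variables from left to right; the values \<open>coef\<close>, \<open>mono\<close>, \<open>acc\<close>
  (coefficient, monomial, polynomial) and the \<open>stack\<close> of truth values are computed from right to
  left, because formulas are in prefix notation and coefficients start with the least significant
  bit. A stack is coded by the base-4 fraction with digits 1 (\<open>False\<close>) and 2 (\<open>True\<close>), so that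
  pushing and popping are linear and the top digit is determined by inequalities.

  States: 0 reads the number of variables; 1 expects a formula or the end; 2--6 are reached after
  the tag bits \<open>0\<close>, \<open>1\<close>, \<open>00\<close>, \<open>01\<close>, \<open>10\<close>; 7 expects a term or the end of a polynomial; 8 a sign bit;
  9 and 10 the next bit of a coefficient or, in 10 only, its end, which excludes leading zeros and
  a negative zero; 11 the value of that bit; 12 the next exponent or the end of the term; 13 is
  inside an exponent.\<close>

record conf =
  idx :: real
  stored :: real
  state :: real
  ctr :: real
  fetched :: real
  num :: real
  coef :: real
  mono :: real
  acc :: real
  stack :: real

text \<open>The stack of the earlier configuration \<open>c\<close> is the result: truth values flow
  from \<open>c'\<close> to \<open>c\<close>, against the reading direction.\<close>

definition push :: "bool \<Rightarrow> conf \<Rightarrow> conf \<Rightarrow> bool" where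
  "push t c c' \<longleftrightarrow> 4 * stack c = (if t then 2 else 1) + stack c'"

text \<open>The number \<open>d\<close> is formed by the two top digits. As the rest of the stack
  has a code in the interval from 0 to 1, the inequalities force these digits to be \<open>s\<close>
  and \<open>t\<close>, and \<open>16 * stack c' - d\<close> is the code of the rest.\<close>

definition replace2 :: "(bool \<Rightarrow> bool \<Rightarrow> bool) \<Rightarrow> bool \<Rightarrow> bool \<Rightarrow> conf \<Rightarrow> conf \<Rightarrow> bool" where
  "replace2 op s t c c' \<longleftrightarrow>
     (let d = 4 * (if s then 2 else 1) + (if t then 2 else 1)
      in d \<le> 16 * stack c' \<and> 16 * stack c' < d + 1 \<and>
         4 * stack c = (if op s t then 2 else 1) + (16 * stack c' - d))"

definition combine :: "(bool \<Rightarrow> bool \<Rightarrow> bool) \<Rightarrow> conf \<Rightarrow> conf \<Rightarrow> bool" where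
  "combine op c c' \<longleftrightarrow> replace2 op True True c c' \<or> replace2 op True False c c' \<or>
     replace2 op False True c c' \<or> replace2 op False False c c'"

definition negate :: "conf \<Rightarrow> conf \<Rightarrow> bool" where
  "negate c c' \<longleftrightarrow> 1 \<le> 4 * stack c' \<and> 4 * stack c' < 2 \<and> 4 * stack c = 4 * stack c' + 1 \<or>
     2 \<le> 4 * stack c' \<and> 4 * stack c' < 3 \<and> 4 * stack c = 4 * stack c' - 1"

text \<open>The number of variables is guessed at the start and passed along unchanged; leaving
  state 0 compares it with the counter.\<close>

definition goto :: "real \<Rightarrow> real \<Rightarrow> conf \<Rightarrow> conf \<Rightarrow> bool" where
  "goto s s' c c' \<longleftrightarrow> state c = s \<and> state c' = s' \<and> num c' = num c"

text \<open>A register not mentioned in a disjunct is free there. For instance \<open>acc\<close> is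
  guessed anew when a polynomial begins, and the chain of equations down to \<open>acc c = 0\<close>
  at its end makes the guess its value.\<close>

definition step1 :: "conf \<Rightarrow> conf \<Rightarrow> bool" where
  "step1 c c' \<longleftrightarrow>
     goto 0 0 c c' \<and> ctr c' = ctr c + 1 \<or>
     goto 1 3 c c' \<and> stack c = stack c' \<or>
     goto 2 5 c c' \<and> stack c = stack c' \<or>
     goto 4 7 c c' \<and> (0 \<le> acc c' \<and> push True c c' \<or> acc c' < 0 \<and> push False c c') \<or>
     goto 5 1 c c' \<and> negate c c' \<or>
     goto 6 1 c c' \<and> combine (\<or>) c c' \<or>
     goto 7 8 c c' \<and> acc c = acc c' \<and> stack c = stack c' \<or>
     goto 8 9 c c' \<and> acc c = acc c' - coef c' * mono c' \<and> stack c = stack c' \<or>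
     (goto 9 11 c c' \<or> goto 10 11 c c') \<and> coef c = coef c' \<and> mono c = mono c' \<and> acc c = acc c' \<and> stack c = stack c' \<or>
     goto 11 10 c c' \<and> coef c = 1 + 2 * coef c' \<and> mono c = mono c' \<and> acc c = acc c' \<and> stack c = stack c' \<or>
     goto 12 13 c c' \<and> ctr c' = ctr c \<and> mono c = mono c' \<and> acc c = acc c' \<and> stack c = stack c' \<or>
     goto 13 13 c c' \<and> ctr c' = ctr c \<and> mono c = fetched c * mono c' \<and> acc c = acc c' \<and> stack c = stack c'"

definition step0 :: "conf \<Rightarrow> conf \<Rightarrow> bool" where
  "step0 c c' \<longleftrightarrow>
     goto 0 1 c c' \<and> ctr c = num c \<and> 4 * stack c' = 2 \<or>
     goto 1 2 c c' \<and> stack c = stack c' \<or>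
     goto 2 4 c c' \<and> stack c = stack c' \<or>
     goto 3 6 c c' \<and> stack c = stack c' \<or>
     goto 4 7 c c' \<and> (acc c' = 0 \<and> push True c c' \<or> acc c' \<noteq> 0 \<and> push False c c') \<or>
     goto 5 7 c c' \<and> (0 < acc c' \<and> push True c c' \<or> acc c' \<le> 0 \<and> push False c c') \<or>
     goto 6 1 c c' \<and> combine (\<and>) c c' \<or>
     goto 7 1 c c' \<and> acc c = 0 \<and> stack c = stack c' \<or>
     goto 8 10 c c' \<and> acc c = acc c' + coef c' * mono c' \<and> stack c = stack c' \<or>
     goto 10 12 c c' \<and> coef c = 0 \<and> ctr c' = 0 \<and> mono c = mono c' \<and> acc c = acc c' \<and> stack c = stack c' \<or>
     goto 11 9 c c' \<and> coef c = 2 * coef c' \<and> mono c = mono c' \<and> acc c = acc c' \<and> stack c = stack c' \<or>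
     goto 12 7 c c' \<and> ctr c = num c \<and> mono c = 1 \<and> acc c = acc c' \<and> stack c = stack c' \<or>
     goto 13 12 c c' \<and> ctr c' = ctr c + 1 \<and> mono c = mono c' \<and> acc c = acc c' \<and> stack c = stack c'"

definition step :: "bool \<Rightarrow> conf \<Rightarrow> conf \<Rightarrow> bool" where
  "step b = (if b then step1 else step0)"

definition final :: "conf \<Rightarrow> bool" where
  "final c \<longleftrightarrow> state c = 1 \<and> stack c = 0"

text \<open>The counter is arbitrary in the states that ignore it, in particular it need not be an integer.\<close>

definition fetch_ok :: "nat \<Rightarrow> (nat \<Rightarrow> real) \<Rightarrow> conf \<Rightarrow> bool" where
  "fetch_ok N x c \<longleftrightarrow> (\<forall>i<N. ctr c = real i \<longrightarrow> fetched c = x i)"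

primrec run :: "nat \<Rightarrow> (nat \<Rightarrow> real) \<Rightarrow> bool list \<Rightarrow> conf \<Rightarrow> bool" where
  "run N x [] c \<longleftrightarrow> fetch_ok N x c \<and> final c"
| "run N x (b # w) c \<longleftrightarrow> fetch_ok N x c \<and> (\<exists>c'. step b c c' \<and> run N x w c')"

section \<open>Stacks of truth values as base-4 fractions\<close>

fun code :: "bool list \<Rightarrow> real" where
  "code [] = 0"
| "code (t # ts) = ((if t then 2 else 1) + code ts) / 4"

lemma code_bounds: "0 \<le> code ts" "code ts < 1"
  by (induction ts) auto

text \<open>The remaining code is less than 1, so it cannot disturb the top digit. As 0 is not a
  digit, the empty stack violates the lower bound.\<close>

lemma code_pop:
  assumes "d \<le> 4 * code ts" "4 * code ts < d + 1" "d = 1 \<or> d = 2"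
  shows "\<exists>ts'. ts = (d = 2) # ts' \<and> code ts' = 4 * code ts - d"
proof (cases ts)
  case Nil
  then show ?thesis using assms by auto
next
  case (Cons t ts')
  then have c: "4 * code ts = (if t then 2 else 1) + code ts'"
    by simp
  have "t = (d = 2)" "code ts' = 4 * code ts - d"
    using assms c code_bounds[of ts'] by (auto split: if_splits)
  with Cons show ?thesis by simp
qed

lemma code_popE:
  assumes "(if t then 2 else 1) \<le> 4 * code ts" "4 * code ts < (if t then 2 else 1) + 1"
  obtains ts' where "ts = t # ts'" "code ts' = 4 * code ts - (if t then 2 else 1)"
proof -
  let ?d = "if t then 2 else 1 :: real"
  have "?d = 1 \<or> ?d = 2" by simp
  from code_pop[OF assms this] obtain ts' where "ts = (?d = 2) # ts'" "code ts' = 4 * code ts - ?d"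
    by (elim exE conjE)
  moreover have "(?d = 2) = t" by simp
  ultimately show thesis
    using that by metis
qed

lemma negate_code:
  assumes "negate c c'" "stack c' = code ts"
  shows "\<exists>t ts'. ts = t # ts' \<and> stack c = code ((\<not> t) # ts')"
proof -
  have "\<exists>t. (if t then 2 else 1) \<le> 4 * code ts \<and> 4 * code ts < (if t then 2 else 1) + 1 \<and>
      4 * stack c = (if t then 1 else 2) + (4 * code ts - (if t then 2 else 1))"
    using assms(1) unfolding negate_def assms(2)
  proof (elim disjE conjE)
    assume "1 \<le> 4 * code ts" "4 * code ts < 2" "4 * stack c = 4 * code ts + 1"
    then show ?thesis by (intro exI[of _ False]) simp
  next
    assume "2 \<le> 4 * code ts" "4 * code ts < 3" "4 * stack c = 4 * code ts - 1"
    then show ?thesis by (intro exI[of _ True]) simp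
  qed
  then obtain t where t: "(if t then 2 else 1) \<le> 4 * code ts" "4 * code ts < (if t then 2 else 1) + 1"
      "4 * stack c = (if t then 1 else 2) + (4 * code ts - (if t then 2 else 1))"
    by (elim exE conjE)
  from t(1,2) obtain ts' where ts': "ts = t # ts'" "code ts' = 4 * code ts - (if t then 2 else 1)"
    by (rule code_popE)
  have "stack c = code ((\<not> t) # ts')"
    using t(3) unfolding ts'(2)[symmetric] by (cases t) simp_all
  with ts'(1) show ?thesis by blast
qed

lemma replace2_code:
  assumes "replace2 op s t c c'" "stack c' = code ts"
  shows "\<exists>s t ts'. ts = s # t # ts' \<and> stack c = code (op s t # ts')"
proof -
  let ?a = "if s then 2 else 1 :: real" and ?b = "if t then 2 else 1 :: real"
  have d: "4 * ?a + ?b \<le> 16 * code ts" "16 * code ts < 4 * ?a + ?b + 1"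
    "4 * stack c = (if op s t then 2 else 1) + (16 * code ts - (4 * ?a + ?b))"
    using assms unfolding replace2_def Let_def by simp_all
  have b: "1 \<le> ?b" "?b \<le> 2" by simp_all
  from d(1,2) b have "?a \<le> 4 * code ts" "4 * code ts < ?a + 1"
    by linarith+
  then obtain ts1 where ts1: "ts = s # ts1" "code ts1 = 4 * code ts - ?a"
    by (rule code_popE)
  from d(1,2) ts1(2) have "?b \<le> 4 * code ts1" "4 * code ts1 < ?b + 1"
    by linarith+
  then obtain ts2 where ts2: "ts1 = t # ts2" "code ts2 = 4 * code ts1 - ?b"
    by (rule code_popE)
  have "4 * stack c = (if op s t then 2 else 1) + code ts2"
    using d(3) ts1(2) ts2(2) by linarith
  then have "stack c = code (op s t # ts2)"
    by simp
  with ts1(1) ts2(1) show ?thesis by blast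
qed

lemma combine_code:
  assumes "combine op c c'" "stack c' = code ts"
  shows "\<exists>s t ts'. ts = s # t # ts' \<and> stack c = code (op s t # ts')"
  using assms(1) replace2_code[OF _ assms(2)] unfolding combine_def by (elim disjE)

text \<open>Popping the digit 2 leaves code 0, which only the empty stack has because all digits are
  positive.\<close>

lemma code_eq_half:
  assumes "4 * code ts = 2"
  shows "ts = [True]"
proof -
  have "(if True then 2 else 1) \<le> 4 * code ts" "4 * code ts < (if True then 2 else 1) + 1"
    using assms by simp_all
  then obtain ts' where ts': "ts = True # ts'" "code ts' = 4 * code ts - (if True then 2 else 1)"
    by (rule code_popE)
  have "code ts' = 0" using ts'(2) assms by simp
  then have "ts' = []"
    using code_bounds[of "tl ts'"] by (cases ts') (auto split: if_splits)
  with ts'(1) show ?thesis by simp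
qed

section \<open>Values of bit strings with the least significant bit first\<close>

definition bits_value :: "bool list \<Rightarrow> nat" where
  "bits_value bs = foldr (\<lambda>b v. of_bool b + 2 * v) bs 0"

lemma bits_value_simps [simp]:
  "bits_value [] = 0" "bits_value (b # bs) = of_bool b + 2 * bits_value bs"
  by (simp_all add: bits_value_def)

lemma bits_value_pos: "bs \<noteq> [] \<Longrightarrow> last bs \<Longrightarrow> bits_value bs > 0"
  by (induction bs) (auto split: if_splits)

text \<open>The condition on the last bit excludes leading zeros, so that the string is the
  canonical one.\<close>

lemma binary_bits_value: "bs = [] \<or> last bs \<Longrightarrow> binary (bits_value bs) = bs"
proof (induction bs)
  case (Cons b bs)
  have "bits_value (b # bs) > 0"
    by (rule bits_value_pos) (use Cons.prems in auto)
  moreover have "binary (bits_value bs) = bs"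
    using Cons by (cases bs) auto
  ultimately show ?case
    by (subst binary.simps) auto
qed (simp add: binary.simps)

lemma bits_value_binary: "bits_value (binary n) = n"
proof (induction n rule: binary.induct)
  case (1 n)
  show ?case
    by (subst binary.simps) (use 1 in \<open>auto simp: of_bool_def odd_two_times_div_two_succ\<close>)
qed

lemma last_binary: "n > 0 \<Longrightarrow> last (binary n)"
proof (induction n rule: binary.induct)
  case (1 n)
  show ?case
  proof (cases "n div 2 = 0")
    case True
    with 1 have "n = 1" by simp
    then show ?thesis by (simp add: binary.simps)
  next
    case False
    then show ?thesis
      using 1 binary.simps[of n] binary.simps[of "n div 2"] by auto
  qed
qed

section \<open>Soundness: every run parses the word and evaluates it\<close>

context
  fixes N :: nat and x :: "nat \<Rightarrow> real"
begin

text \<open>The counter stays at \<open>i\<close> throughout state 13, where \<open>fetch_ok\<close>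
  makes the fetched value equal to \<open>x i\<close>; each \<open>True\<close> contributes one
  factor.\<close>

lemma run_power:
  assumes "run N x w c" "state c = 13" "ctr c = real i" "i < N"
  obtains e w' c' where "w = enc_unary e @ w'" "run N x w' c'" "state c' = 12" "ctr c' = real (Suc i)"
    "num c' = num c" "mono c = x i ^ e * mono c'" "acc c = acc c'" "stack c = stack c'"
proof -
  have "\<exists>e w' c'. w = enc_unary e @ w' \<and> run N x w' c' \<and> state c' = 12 \<and> ctr c' = real (Suc i) \<and>
    num c' = num c \<and> mono c = x i ^ e * mono c' \<and> acc c = acc c' \<and> stack c = stack c'"
    using assms
  proof (induction w arbitrary: c)
    case Nil
    then show ?case by (simp add: final_def)
  next
    case (Cons b w)
    then obtain c' where c': "step b c c'" "run N x w c'" and f: "fetched c = x i"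
      by (auto simp: fetch_ok_def)
    show ?case
    proof (cases b)
      case True
      with c' Cons.prems(2,3) have s: "state c' = 13" "num c' = num c" "ctr c' = real i"
          "mono c = x i * mono c'" "acc c = acc c'" "stack c = stack c'"
        by (auto simp: step_def step1_def goto_def f)
      from Cons.IH[OF c'(2) s(1,3) Cons.prems(4)] obtain e w' c'' where
        "w = enc_unary e @ w'" "run N x w' c''" "state c'' = 12" "ctr c'' = real (Suc i)"
        "num c'' = num c'" "mono c' = x i ^ e * mono c''" "acc c' = acc c''" "stack c' = stack c''"
        by blast
      with s True show ?thesis
        by (intro exI[of _ "Suc e"] exI[of _ w'] exI[of _ c'']) (simp add: enc_unary_def)
    next
      case False
      with c' Cons.prems(2,3) show ?thesis
        by (intro exI[of _ 0] exI[of _ w] exI[of _ c'])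
          (auto simp: step_def step0_def goto_def enc_unary_def)
    qed
  qed
  then show ?thesis using that by blast
qed

lemma run_Cons:
  assumes "run N x w c" "state c \<noteq> 1"
  obtains b w' c' where "w = b # w'" "step b c c'" "run N x w' c'"
  using assms by (cases w) (auto simp: final_def)

text \<open>Every exponent consumes letters of the word, so \<open>i + length w \<le> N\<close> is
  preserved and the counter stays in the range in which fetched values are reliable. The comparison
  with \<open>num\<close> at the end fixes the length of the exponent list.\<close>

lemma run_exponents:
  assumes "run N x w c" "state c = 12" "ctr c = real i" "num c = real n" "i + length w \<le> N"
  shows "\<exists>es w' c'. w = enc_list enc_unary es @ w' \<and> run N x w' c' \<and> state c' = 7 \<and>
    num c' = num c \<and> i + length es = n \<and> mono c = (\<Prod>k<length es. x (i + k) ^ (es ! k)) \<and>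
    acc c = acc c' \<and> stack c = stack c'"
  using assms
proof (induction "length w" arbitrary: w c i rule: less_induct)
  case less
  obtain b w0 c' where w: "w = b # w0" and c': "step b c c'" "run N x w0 c'"
    by (rule run_Cons[OF less.prems(1)]) (use less.prems(2) in auto)
  show ?case
  proof (cases b)
    case True
    with c' less.prems(2,3) have s: "state c' = 13" "num c' = num c" "ctr c' = real i"
        "mono c = mono c'" "acc c = acc c'" "stack c = stack c'"
      by (auto simp: step_def step1_def goto_def)
    have i: "i < N" using less.prems(5) w by simp
    obtain e w1 c1 where 1: "w0 = enc_unary e @ w1"
      "run N x w1 c1" "state c1 = 12" "ctr c1 = real (Suc i)" "num c1 = num c'"
      "mono c' = x i ^ e * mono c1" "acc c' = acc c1" "stack c' = stack c1"
      by (rule run_power[OF c'(2) s(1,3) i])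
    have n1: "num c1 = real n"
      using 1(5) s(2) less.prems(4) by simp
    have "length w1 < length w" "Suc i + length w1 \<le> N"
      using w 1(1) less.prems(5) by auto
    from less.hyps[OF this(1) 1(2-4) n1 this(2)] obtain es w' c'' where
      2: "w1 = enc_list enc_unary es @ w'" "run N x w' c''" "state c'' = 7" "num c'' = num c1"
      "Suc i + length es = n" "mono c1 = (\<Prod>k<length es. x (Suc i + k) ^ (es ! k))"
      "acc c1 = acc c''" "stack c1 = stack c''" by (elim exE conjE)
    have "mono c = (\<Prod>k<length (e # es). x (i + k) ^ ((e # es) ! k))"
      unfolding s(4) 1(6) 2(6) by (simp add: prod.lessThan_Suc_shift del: prod.lessThan_Suc)
    with s 1 2 w True show ?thesis
      by (intro exI[of _ "e # es"] exI[of _ w'] exI[of _ c'']) (simp add: enc_list_simps)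
  next
    case False
    with c' less.prems(2) have s: "state c' = 7" "num c' = num c" "ctr c = num c"
        "mono c = 1" "acc c = acc c'" "stack c = stack c'"
      by (auto simp: step_def step0_def goto_def)
    with less.prems(3,4) have "i = n" by simp
    with s c'(2) w False show ?thesis
      by (intro exI[of _ "[]"] exI[of _ w0] exI[of _ c']) (simp add: enc_list_simps)
  qed
qed

text \<open>The run passes to state 10 after a bit \<open>True\<close> and to state 9 after a bit
  \<open>False\<close>, and only state 10 may end the string. The last two conjuncts record this for
  the sign and for canonicity.\<close>

lemma run_coefficient:
  assumes "run N x w c" "state c = 9 \<or> state c = 10"
  shows "\<exists>bs w' c'. w = enc_list (\<lambda>b. [b]) bs @ w' \<and> run N x w' c' \<and> state c' = 12 \<and>
    num c' = num c \<and> ctr c' = 0 \<and> coef c = real (bits_value bs) \<and> mono c = mono c' \<and>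
    acc c = acc c' \<and> stack c = stack c' \<and> (bs = [] \<longrightarrow> state c = 10) \<and> (bs \<noteq> [] \<longrightarrow> last bs)"
  using assms
proof (induction "length w" arbitrary: w c rule: less_induct)
  case less
  obtain b w0 c' where w: "w = b # w0" and c': "step b c c'" "run N x w0 c'"
    by (rule run_Cons[OF less.prems(1)]) (use less.prems(2) in auto)
  show ?case
  proof (cases b)
    case True
    with c' less.prems(2) have s: "state c' = 11" "num c' = num c" "coef c = coef c'"
        "mono c = mono c'" "acc c = acc c'" "stack c = stack c'"
      by (auto simp: step_def step1_def goto_def)
    obtain b' w1 c1 where w0: "w0 = b' # w1" and c1: "step b' c' c1" "run N x w1 c1"
      by (rule run_Cons[OF c'(2)]) (use s(1) in auto)
    have t: "state c1 = (if b' then 10 else 9)" "num c1 = num c'" "coef c' = of_bool b' + 2 * coef c1"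
        "mono c' = mono c1" "acc c' = acc c1" "stack c' = stack c1"
      using c1(1) s(1) by (auto simp: step_def step0_def step1_def goto_def split: if_splits)
    have "length w1 < length w" "state c1 = 9 \<or> state c1 = 10"
      using w w0 t(1) by auto
    from less.hyps[OF this(1) c1(2) this(2)] obtain bs w' c'' where
      2: "w1 = enc_list (\<lambda>b. [b]) bs @ w'" "run N x w' c''" "state c'' = 12" "num c'' = num c1"
      "ctr c'' = 0" "coef c1 = real (bits_value bs)" "mono c1 = mono c''" "acc c1 = acc c''"
      "stack c1 = stack c''" "bs = [] \<longrightarrow> state c1 = 10" "bs \<noteq> [] \<longrightarrow> last bs" by (elim exE conjE)
    show ?thesis
      by (rule exI[of _ "b' # bs"], rule exI[of _ w'], rule exI[of _ c''])
        (use s t 2 w w0 True in \<open>auto simp: enc_list_simps split: if_splits\<close>)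
  next
    case False
    with c' less.prems(2) have s: "state c' = 12" "num c' = num c" "ctr c' = 0" "coef c = 0"
        "mono c = mono c'" "acc c = acc c'" "stack c = stack c'" "state c = 10"
      by (auto simp: step_def step0_def goto_def)
    with c'(2) w False show ?thesis
      by (intro exI[of _ "[]"] exI[of _ w0] exI[of _ c']) (simp add: enc_list_simps)
  qed
qed

lemma run_term:
  assumes "run N x w c" "state c = 8" "num c = real n" "length w \<le> N"
  shows "\<exists>z es w' c'. w = enc_term (z, es) @ w' \<and> run N x w' c' \<and> state c' = 7 \<and> num c' = num c \<and>
    length es = n \<and> acc c = acc c' + of_int z * (\<Prod>k<length es. x k ^ (es ! k)) \<and> stack c = stack c'"
proof -
  obtain b w0 c0 where w: "w = b # w0" and c0: "step b c c0" "run N x w0 c0"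
    by (rule run_Cons[OF assms(1)]) (use assms(2) in auto)
  have s: "state c0 = (if b then 9 else 10)" "num c0 = num c" "stack c = stack c0"
    "acc c = acc c0 + (if b then -1 else 1) * (coef c0 * mono c0)"
    using c0(1) assms(2) by (auto simp: step_def step0_def step1_def goto_def split: if_splits)
  have "state c0 = 9 \<or> state c0 = 10" using s(1) by simp
  from run_coefficient[OF c0(2) this] obtain bs w1 c1 where
    1: "w0 = enc_list (\<lambda>b. [b]) bs @ w1" "run N x w1 c1" "state c1 = 12" "num c1 = num c0"
    "ctr c1 = 0" "coef c0 = real (bits_value bs)" "mono c0 = mono c1" "acc c0 = acc c1"
    "stack c0 = stack c1" "bs = [] \<longrightarrow> state c0 = 10" "bs \<noteq> [] \<longrightarrow> last bs" by (elim exE conjE)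
  have "0 + length w1 \<le> N" "ctr c1 = real 0" "num c1 = real n"
    using assms(3,4) w 1(1,4,5) s(2) by simp_all
  from run_exponents[OF 1(2,3) this(2,3,1)] obtain es w' c' where
    2: "w1 = enc_list enc_unary es @ w'" "run N x w' c'" "state c' = 7" "num c' = num c1"
    "0 + length es = n" "mono c1 = (\<Prod>k<length es. x (0 + k) ^ (es ! k))" "acc c1 = acc c'"
    "stack c1 = stack c'" by (elim exE conjE)
  define z where "z = (if b then -1 else 1) * int (bits_value bs)"
  \<comment> \<open>A negative sign leads to state 9, which requires a nonempty string ending in
    \<open>True\<close>; hence \<open>z\<close> is nonzero and the sign bit agrees with
    \<open>z < 0\<close>.\<close>
  have "b \<Longrightarrow> bits_value bs > 0"
    using 1(10,11) s(1) bits_value_pos[of bs] by auto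
  then have "(z < 0) = b" by (auto simp: z_def)
  moreover have "binary (nat \<bar>z\<bar>) = bs"
    using binary_bits_value[of bs] 1(11) by (auto simp: z_def abs_mult)
  ultimately have "w = enc_term (z, es) @ w'"
    using w 1(1) 2(1) by (simp add: enc_term_def enc_int_def)
  moreover have "acc c = acc c' + of_int z * (\<Prod>k<length es. x k ^ (es ! k))"
    using s(4) 1(6,7,8) 2(6,7) by (simp add: z_def)
  ultimately show ?thesis
    using 2 1 s by (intro exI[of _ z] exI[of _ es] exI[of _ w'] exI[of _ c']) simp
qed

lemma run_poly:
  assumes "run N x w c" "state c = 7" "num c = real n" "length w \<le> N"
  shows "\<exists>p w' c'. w = enc_poly p @ w' \<and> is_poly n p \<and> run N x w' c' \<and> state c' = 1 \<and> num c' = num c \<and>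
    acc c = eval_poly p x \<and> stack c = stack c'"
  using assms
proof (induction "length w" arbitrary: w c rule: less_induct)
  case less
  obtain b w0 c' where w: "w = b # w0" and c': "step b c c'" "run N x w0 c'"
    by (rule run_Cons[OF less.prems(1)]) (use less.prems(2) in auto)
  show ?case
  proof (cases b)
    case True
    with c' less.prems(2) have s: "state c' = 8" "num c' = num c" "acc c = acc c'" "stack c = stack c'"
      by (auto simp: step_def step1_def goto_def)
    have "num c' = real n" "length w0 \<le> N"
      using s(2) less.prems(3,4) w by simp_all
    from run_term[OF c'(2) s(1) this] obtain z es w1 c1 where
      1: "w0 = enc_term (z, es) @ w1" "run N x w1 c1" "state c1 = 7" "num c1 = num c'" "length es = n"
      "acc c' = acc c1 + of_int z * (\<Prod>k<length es. x k ^ (es ! k))" "stack c' = stack c1" by (elim exE conjE)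
    have "length w1 < length w" "num c1 = real n" "length w1 \<le> N"
      using w 1(1,4) s(2) less.prems(3,4) by auto
    from less.hyps[OF this(1) 1(2,3) this(2,3)] obtain p w' c'' where
      2: "w1 = enc_poly p @ w'" "is_poly n p" "run N x w' c''" "state c'' = 1" "num c'' = num c1"
      "acc c1 = eval_poly p x" "stack c1 = stack c''" by (elim exE conjE)
    show ?thesis
      by (rule exI[of _ "(z, es) # p"], rule exI[of _ w'], rule exI[of _ c''])
        (use s 1 2 w True in \<open>simp add: enc_poly_def enc_list_simps is_poly_def eval_poly_def\<close>)
  next
    case False
    with c' less.prems(2) have s: "state c' = 1" "num c' = num c" "acc c = 0" "stack c = stack c'"
      by (auto simp: step_def step0_def goto_def)
    with c'(2) w False show ?thesis
      by (intro exI[of _ "[]"] exI[of _ w0] exI[of _ c'])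
        (simp add: enc_poly_def enc_list_simps is_poly_def eval_poly_def)
  qed
qed

lemma map_eq_two:
  assumes "map f xs = s # t # ts"
  obtains y z zs where "xs = y # z # zs" "s = f y" "t = f z" "ts = map f zs"
proof -
  from assms obtain y ys where y: "xs = y # ys" "s = f y" "map f ys = t # ts"
    by (cases xs) auto
  from y(3) obtain z zs where "ys = z # zs" "t = f z" "ts = map f zs"
    by (cases ys) auto
  with y(1,2) show thesis
    by (intro that[of y z zs]) simp_all
qed

text \<open>A suffix of a formula in prefix notation is a sequence of formulas, so the induction has
  to speak of lists. The stack consists of their truth values, and a connective pops those of its
  arguments.\<close>

lemma run_formulas:
  assumes "run N x w c" "state c = 1" "num c = real n" "length w \<le> N"
  shows "\<exists>\<phi>s. w = concat (map enc_formula \<phi>s) \<and> (\<forall>\<phi>\<in>set \<phi>s. is_formula n \<phi>) \<and>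
    stack c = code (map (\<lambda>\<phi>. holds \<phi> x) \<phi>s)"
  using assms
proof (induction "length w" arbitrary: w c rule: less_induct)
  case less
  show ?case
  proof (cases w)
    case Nil
    with less.prems show ?thesis
      by (intro exI[of _ "[]"]) (simp add: final_def)
  next
    case w: (Cons b1 w1)
    with less.prems(1) obtain c1 where c1: "step b1 c c1" "run N x w1 c1" by auto
    have s1: "state c1 = (if b1 then 3 else 2)" "num c1 = num c" "stack c = stack c1"
      using c1(1) less.prems(2) by (auto simp: step_def step0_def step1_def goto_def split: if_splits)
    have "state c1 \<noteq> 1" using s1(1) by simp
    then obtain b2 w2 c2 where w1: "w1 = b2 # w2" and c2: "step b2 c1 c2" "run N x w2 c2"
      by (rule run_Cons[OF c1(2)])
    \<comment> \<open>State 3 has no transition under \<open>True\<close>, which rules out tags that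
      begin with two ones.\<close>
    have s2: "state c2 = (if b1 then 6 else if b2 then 5 else 4)" "num c2 = num c1" "stack c1 = stack c2"
        "\<not> (b1 \<and> b2)"
      using c2(1) s1(1) by (auto simp: step_def step0_def step1_def goto_def split: if_splits)
    have "state c2 \<noteq> 1" using s2(1) by simp
    then obtain b3 w3 c3 where w2: "w2 = b3 # w3" and c3: "step b3 c2 c3" "run N x w3 c3"
      by (rule run_Cons[OF c2(2)])
    have num: "num c3 = real n"
      using c3(1) s1(2) s2(2) less.prems(3)
      by (auto simp: step_def step0_def step1_def goto_def split: if_splits)
    have len: "length w3 < length w" "length w3 \<le> N"
      using w w1 w2 less.prems(4) by simp_all
    have stk: "stack c = stack c2" using s1(3) s2(3) by simp
    have w': "w = [b1, b2, b3] @ w3" using w w1 w2 by simp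
    \<comment> \<open>The three kinds of atoms differ only in the constructor \<open>A\<close> and
      in the condition on \<open>acc\<close> under which the push is \<open>True\<close>.\<close>
    have atom: ?thesis
      if A: "\<And>p. enc_formula (A p) = [b1, b2, b3] @ enc_poly p" "\<And>p. is_formula n (A p) = is_poly n p"
        "state c3 = 7" "\<And>p. eval_poly p x = acc c3 \<Longrightarrow> push (holds (A p) x) c2 c3" for A
    proof -
      from run_poly[OF c3(2) A(3) num len(2)] obtain p w4 c4 where 1: "w3 = enc_poly p @ w4"
        "is_poly n p" "run N x w4 c4" "state c4 = 1" "num c4 = num c3" "acc c3 = eval_poly p x"
        "stack c3 = stack c4" by (elim exE conjE)
      have "length w4 < length w" "num c4 = real n" "length w4 \<le> N"
        using 1(1,5) num len by simp_all
      from less.hyps[OF this(1) 1(3,4) this(2,3)] obtain \<phi>s where 2: "w4 = concat (map enc_formula \<phi>s)"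
        "\<forall>\<phi>\<in>set \<phi>s. is_formula n \<phi>" "stack c4 = code (map (\<lambda>\<phi>. holds \<phi> x) \<phi>s)" by (elim exE conjE)
      have "4 * stack c = (if holds (A p) x then 2 else 1) + stack c4"
        using A(4)[OF 1(6)[symmetric]] stk 1(7) by (simp add: push_def)
      then show ?thesis
        by (intro exI[of _ "A p # \<phi>s"]) (use 1 2 A(1,2) w' in simp)
    qed
    have rest: "\<exists>\<phi>s. w3 = concat (map enc_formula \<phi>s) \<and> (\<forall>\<phi>\<in>set \<phi>s. is_formula n \<phi>) \<and>
        stack c3 = code (map (\<lambda>\<phi>. holds \<phi> x) \<phi>s)" if "state c3 = 1"
      by (rule less.hyps[OF len(1) c3(2) that num len(2)])
    have binop: ?thesis
      if B: "\<And>\<phi> \<psi>. enc_formula (B \<phi> \<psi>) = [b1, b2, b3] @ enc_formula \<phi> @ enc_formula \<psi>"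
        "\<And>\<phi> \<psi>. is_formula n (B \<phi> \<psi>) = (is_formula n \<phi> \<and> is_formula n \<psi>)"
        "\<And>\<phi> \<psi>. holds (B \<phi> \<psi>) x = op (holds \<phi> x) (holds \<psi> x)"
        "state c3 = 1" "combine op c2 c3" for B op
    proof -
      from rest[OF B(4)] obtain \<phi>s where 2: "w3 = concat (map enc_formula \<phi>s)"
        "\<forall>\<phi>\<in>set \<phi>s. is_formula n \<phi>" "stack c3 = code (map (\<lambda>\<phi>. holds \<phi> x) \<phi>s)" by (elim exE conjE)
      from combine_code[OF B(5) 2(3)] obtain s t ts where 3: "map (\<lambda>\<phi>. holds \<phi> x) \<phi>s = s # t # ts"
        "stack c2 = code (op s t # ts)" by (elim exE conjE)
      from 3(1) obtain \<phi> \<psi> \<phi>s' where "\<phi>s = \<phi> # \<psi> # \<phi>s'" "s = holds \<phi> x" "t = holds \<psi> x"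
        "ts = map (\<lambda>\<phi>. holds \<phi> x) \<phi>s'" by (rule map_eq_two)
      with 2 3(2) B(1-3) w' stk show ?thesis
        by (intro exI[of _ "B \<phi> \<psi> # \<phi>s'"]) (simp del: code.simps)
    qed
    consider "\<not> b1" "\<not> b2" "\<not> b3" | "\<not> b1" "\<not> b2" b3 | "\<not> b1" b2 "\<not> b3" | "\<not> b1" b2 b3
      | b1 "\<not> b2" "\<not> b3" | b1 "\<not> b2" b3
      using s2(4) by blast
    then show ?thesis
    proof cases
      case 1
      then show ?thesis
        using c3(1) s2(1) by (intro atom[of EqZero]) (auto simp: step_def step0_def goto_def)
    next
      case 2
      then show ?thesis
        using c3(1) s2(1) by (intro atom[of GeZero]) (auto simp: step_def step1_def goto_def)
    next
      case 3
      then show ?thesis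
        using c3(1) s2(1) by (intro atom[of GtZero]) (auto simp: step_def step0_def goto_def)
    next
      case 4
      then have s3: "state c3 = 1" "negate c2 c3"
        using c3(1) s2(1) by (auto simp: step_def step1_def goto_def)
      from rest[OF s3(1)] obtain \<phi>s where 2: "w3 = concat (map enc_formula \<phi>s)"
        "\<forall>\<phi>\<in>set \<phi>s. is_formula n \<phi>" "stack c3 = code (map (\<lambda>\<phi>. holds \<phi> x) \<phi>s)" by (elim exE conjE)
      from negate_code[OF s3(2) 2(3)] obtain t ts where 3: "map (\<lambda>\<phi>. holds \<phi> x) \<phi>s = t # ts"
        "stack c2 = code ((\<not> t) # ts)" by (elim exE conjE)
      from 3(1) obtain \<phi> \<phi>s' where "\<phi>s = \<phi> # \<phi>s'" "t = holds \<phi> x" "ts = map (\<lambda>\<phi>. holds \<phi> x) \<phi>s'"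
        by (cases \<phi>s) auto
      with 2 3(2) w' stk 4 show ?thesis
        by (intro exI[of _ "Neg \<phi> # \<phi>s'"]) (simp del: code.simps)
    next
      case 5
      then have "state c3 = 1" "combine (\<and>) c2 c3"
        using c3(1) s2(1) by (auto simp: step_def step0_def goto_def)
      with 5 show ?thesis
        by (intro binop[of Conj "(\<and>)"]) simp_all
    next
      case 6
      then have "state c3 = 1" "combine (\<or>) c2 c3"
        using c3(1) s2(1) by (auto simp: step_def step1_def goto_def)
      with 6 show ?thesis
        by (intro binop[of Disj "(\<or>)"]) simp_all
    qed
  qed
qed

text \<open>The start of the formula part requires four times the stack to be 2, so exactly one
  formula follows and it is true.\<close>

lemma run_sentence:
  assumes "run N x w c" "state c = 0" "ctr c = real i" "length w \<le> N"
  shows "\<exists>k \<phi>. w = enc_sentence k \<phi> \<and> is_formula (i + k) \<phi> \<and> holds \<phi> x"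
  using assms
proof (induction w arbitrary: c i)
  case Nil
  then show ?case by (simp add: final_def)
next
  case (Cons b w)
  then obtain c' where c': "step b c c'" "run N x w c'" by auto
  show ?case
  proof (cases b)
    case True
    with c' Cons.prems(2,3) have "state c' = 0" "ctr c' = real (Suc i)" "length w \<le> N"
      using Cons.prems(4) by (auto simp: step_def step1_def goto_def)
    from Cons.IH[OF c'(2) this] obtain k \<phi> where "w = enc_sentence k \<phi>" "is_formula (Suc i + k) \<phi>"
      "holds \<phi> x" by (elim exE conjE)
    with True show ?thesis
      by (intro exI[of _ "Suc k"] exI[of _ \<phi>]) (simp add: enc_sentence_def enc_unary_def)
  next
    case False
    with c' Cons.prems(2,3) have s: "state c' = 1" "num c' = real i" "4 * stack c' = 2" "length w \<le> N"
      using Cons.prems(4) by (auto simp: step_def step0_def goto_def)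
    from run_formulas[OF c'(2) s(1,2,4)] obtain \<phi>s where 2: "w = concat (map enc_formula \<phi>s)"
      "\<forall>\<phi>\<in>set \<phi>s. is_formula i \<phi>" "stack c' = code (map (\<lambda>\<phi>. holds \<phi> x) \<phi>s)" by (elim exE conjE)
    from s(3) 2(3) have "map (\<lambda>\<phi>. holds \<phi> x) \<phi>s = [True]"
      by (intro code_eq_half) simp
    then obtain \<phi> where "\<phi>s = [\<phi>]" "holds \<phi> x" by auto
    with 2 False show ?thesis
      by (intro exI[of _ 0] exI[of _ \<phi>]) (simp add: enc_sentence_def enc_unary_def)
  qed
qed

section \<open>Completeness: runs built from right to left\<close>

definition canonical :: "real \<Rightarrow> nat \<Rightarrow> nat \<Rightarrow> real \<Rightarrow> real \<Rightarrow> real \<Rightarrow> real \<Rightarrow> conf" where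
  "canonical q i n A M S T = \<lparr>idx = 0, stored = 0, state = q, ctr = real i, fetched = x i, num = real n,
     coef = A, mono = M, acc = S, stack = T\<rparr>"

text \<open>The fetched value always belongs to the counter, even in states that ignore both, so the
  access condition holds by construction.\<close>

lemma fetch_ok_canonical [simp]: "fetch_ok N x (canonical q i n A M S T)"
  by (simp add: fetch_ok_def canonical_def)

lemma canonical_simps [simp]:
  "state (canonical q i n A M S T) = q" "ctr (canonical q i n A M S T) = real i"
  "fetched (canonical q i n A M S T) = x i" "num (canonical q i n A M S T) = real n"
  "coef (canonical q i n A M S T) = A" "mono (canonical q i n A M S T) = M"
  "acc (canonical q i n A M S T) = S" "stack (canonical q i n A M S T) = T"
  by (simp_all add: canonical_def)

lemma run_canonicalI:
  "run N x w c' \<Longrightarrow> step b (canonical q i n A M S T) c' \<Longrightarrow> run N x (b # w) (canonical q i n A M S T)"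
  by auto

lemmas step_simps = step_def step0_def step1_def goto_def

text \<open>This and the following completeness lemmas extend a run by a prefix of the word, in the
  direction in which the values are computed.\<close>

lemma complete_power:
  "run N x w (canonical 12 (Suc i) n 0 M S T) \<Longrightarrow>
   run N x (enc_unary e @ w) (canonical 13 i n 0 (x i ^ e * M) S T)"
proof (induction e)
  case 0
  then show ?case
    unfolding enc_unary_def by simp (rule exI, rule conjI[rotated], assumption, simp add: step_simps)
next
  case (Suc e)
  have "step True (canonical 13 i n 0 (x i ^ Suc e * M) S T) (canonical 13 i n 0 (x i ^ e * M) S T)"
    by (simp add: step_simps)
  from run_canonicalI[OF Suc.IH[OF Suc.prems] this] show ?case
    by (simp add: enc_unary_def)
qed

lemma complete_exponents:
  assumes "run N x w (canonical 7 0 n 0 0 S T)"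
  shows "i + length es = n \<Longrightarrow> run N x (enc_list enc_unary es @ w)
    (canonical 12 i n 0 (\<Prod>k<length es. x (i + k) ^ (es ! k)) S T)"
proof (induction es arbitrary: i)
  case Nil
  have "step False (canonical 12 i n 0 1 S T) (canonical 7 0 n 0 0 S T)"
    using Nil by (simp add: step_simps)
  from run_canonicalI[OF assms this] show ?case
    by (simp add: enc_list_simps)
next
  case (Cons e es)
  let ?M = "\<Prod>k<length es. x (Suc i + k) ^ (es ! k)"
  have "run N x (enc_list enc_unary es @ w) (canonical 12 (Suc i) n 0 ?M S T)"
    by (rule Cons.IH) (use Cons.prems in simp)
  note 1 = complete_power[OF this, of e]
  have "step True (canonical 12 i n 0 (x i ^ e * ?M) S T) (canonical 13 i n 0 (x i ^ e * ?M) S T)"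
    by (simp add: step_simps)
  note 2 = run_canonicalI[OF 1 this]
  have "x i ^ e * ?M = (\<Prod>k<length (e # es). x (i + k) ^ ((e # es) ! k))"
    by (simp add: prod.lessThan_Suc_shift del: prod.lessThan_Suc)
  with 2 show ?case
    by (simp add: enc_list_simps)
qed

lemma complete_coefficient:
  assumes "run N x w (canonical 12 0 n 0 M S T)"
  shows "bs = [] \<or> last bs \<Longrightarrow> q = 9 \<or> q = 10 \<Longrightarrow> bs = [] \<longrightarrow> q = 10 \<Longrightarrow>
    run N x (enc_list (\<lambda>b. [b]) bs @ w) (canonical q 0 n (real (bits_value bs)) M S T)"
proof (induction bs arbitrary: q)
  case Nil
  have "step False (canonical q 0 n 0 M S T) (canonical 12 0 n 0 M S T)"
    using Nil by (simp add: step_simps)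
  from run_canonicalI[OF assms this] show ?case
    by (simp add: enc_list_simps)
next
  case (Cons b bs)
  let ?q = "if b then 10 else 9 :: real"
  let ?A = "real (bits_value bs)"
  have "run N x (enc_list (\<lambda>b. [b]) bs @ w) (canonical ?q 0 n ?A M S T)"
    by (rule Cons.IH) (use Cons.prems(1) in \<open>auto split: if_splits\<close>)
  moreover have "step b (canonical 11 0 n (of_bool b + 2 * ?A) M S T) (canonical ?q 0 n ?A M S T)"
    by (simp add: step_simps)
  ultimately have 1: "run N x (b # enc_list (\<lambda>b. [b]) bs @ w) (canonical 11 0 n (of_bool b + 2 * ?A) M S T)"
    by (rule run_canonicalI)
  have "step True (canonical q 0 n (of_bool b + 2 * ?A) M S T) (canonical 11 0 n (of_bool b + 2 * ?A) M S T)"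
    using Cons.prems(2) by (auto simp: step_simps)
  from run_canonicalI[OF 1 this] show ?case
    by (simp add: enc_list_simps)
qed

lemma complete_term:
  assumes "run N x w (canonical 7 0 n 0 0 S T)" "length es = n"
  shows "run N x (enc_term (z, es) @ w)
    (canonical 8 0 n 0 0 (of_int z * (\<Prod>k<length es. x k ^ (es ! k)) + S) T)"
proof -
  let ?M = "\<Prod>k<length es. x k ^ (es ! k)"
  let ?bs = "binary (nat \<bar>z\<bar>)"
  let ?q = "if z < 0 then 9 else 10 :: real"
  have "run N x (enc_list enc_unary es @ w) (canonical 12 0 n 0 ?M S T)"
    using complete_exponents[OF assms(1), of 0 es] assms(2) by simp
  moreover have "?bs = [] \<or> last ?bs"
    using last_binary[of "nat \<bar>z\<bar>"] by (cases "z = 0") (auto simp: binary.simps)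
  moreover have "?bs = [] \<longrightarrow> ?q = 10"
    by (subst binary.simps) auto
  ultimately have 1: "run N x (enc_list (\<lambda>b. [b]) ?bs @ enc_list enc_unary es @ w)
      (canonical ?q 0 n (real (bits_value ?bs)) ?M S T)"
    by (intro complete_coefficient) auto
  have "step (z < 0) (canonical 8 0 n 0 0 (of_int z * ?M + S) T)
      (canonical ?q 0 n (real (bits_value ?bs)) ?M S T)"
    by (simp add: step_simps bits_value_binary)
  from run_canonicalI[OF 1 this] show ?thesis
    by (simp add: enc_term_def enc_int_def)
qed

lemma complete_poly:
  assumes "run N x w (canonical 1 0 n 0 0 0 T)"
  shows "is_poly n p \<Longrightarrow> run N x (enc_poly p @ w) (canonical 7 0 n 0 0 (eval_poly p x) T)"
proof (induction p)
  case Nil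
  have "step False (canonical 7 0 n 0 0 0 T) (canonical 1 0 n 0 0 0 T)"
    by (simp add: step_simps)
  from run_canonicalI[OF assms this] show ?case
    by (simp add: enc_poly_def enc_list_simps eval_poly_def)
next
  case (Cons t p)
  obtain z es where t: "t = (z, es)" by (cases t)
  with Cons.prems have "length es = n" "is_poly n p"
    by (auto simp: is_poly_def)
  from complete_term[OF Cons.IH[OF this(2)] this(1), of z]
  have 1: "run N x (enc_term t @ enc_poly p @ w) (canonical 8 0 n 0 0 (eval_poly (t # p) x) T)"
    by (simp add: eval_poly_def t)
  have "step True (canonical 7 0 n 0 0 (eval_poly (t # p) x) T) (canonical 8 0 n 0 0 (eval_poly (t # p) x) T)"
    by (simp add: step_simps)
  from run_canonicalI[OF 1 this] show ?case
    by (simp add: enc_poly_def enc_list_simps)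
qed

lemma negate_codeI:
  "stack c = code ((\<not> t) # ts) \<Longrightarrow> stack c' = code (t # ts) \<Longrightarrow> negate c c'"
  using code_bounds[of ts] by (cases t) (simp_all add: negate_def)

lemma combine_codeI:
  "stack c = code (op s t # ts) \<Longrightarrow> stack c' = code (s # t # ts) \<Longrightarrow> combine op c c'"
proof -
  assume st: "stack c = code (op s t # ts)" "stack c' = code (s # t # ts)"
  have c: "4 * stack c = (if op s t then 2 else 1) + code ts"
    unfolding st code.simps by (simp del: if_split)
  have c': "16 * stack c' = 4 * (if s then 2 else 1) + (if t then 2 else 1) + code ts"
    unfolding st code.simps by (cases s; cases t) simp_all
  have "replace2 op s t c c'"
    unfolding replace2_def Let_def c c' using code_bounds[of ts] by (simp del: if_split)
  then show "combine op c c'"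
    unfolding combine_def by (cases s; cases t) simp_all
qed

lemma complete_tag:
  assumes "run N x w c3" "step b3 (canonical (if b1 then 6 else if b2 then 5 else 4) 0 n 0 0 0 T) c3"
    "\<not> (b1 \<and> b2)"
  shows "run N x ([b1, b2, b3] @ w) (canonical 1 0 n 0 0 0 T)"
proof -
  have "step b2 (canonical (if b1 then 3 else 2) 0 n 0 0 0 T)
      (canonical (if b1 then 6 else if b2 then 5 else 4) 0 n 0 0 0 T)"
    using assms(3) by (simp add: step_simps)
  note 1 = run_canonicalI[OF run_canonicalI[OF assms(1,2)] this]
  have "step b1 (canonical 1 0 n 0 0 0 T) (canonical (if b1 then 3 else 2) 0 n 0 0 0 T)"
    by (simp add: step_simps)
  from run_canonicalI[OF 1 this] show ?thesis
    by simp
qed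

lemma complete_formula:
  "is_formula n \<phi> \<Longrightarrow> run N x w (canonical 1 0 n 0 0 0 (code ts)) \<Longrightarrow>
   run N x (enc_formula \<phi> @ w) (canonical 1 0 n 0 0 0 (code (holds \<phi> x # ts)))"
proof (induction \<phi> arbitrary: w ts)
  case (EqZero p)
  from complete_poly[OF EqZero.prems(2), of p] EqZero.prems(1)
  show ?case
    by (simp only: enc_formula.simps append_assoc) (rule complete_tag, auto simp: step_simps push_def)
next
  case (GeZero p)
  from complete_poly[OF GeZero.prems(2), of p] GeZero.prems(1)
  show ?case
    by (simp only: enc_formula.simps append_assoc) (rule complete_tag, auto simp: step_simps push_def)
next
  case (GtZero p)
  from complete_poly[OF GtZero.prems(2), of p] GtZero.prems(1)
  show ?case
    by (simp only: enc_formula.simps append_assoc) (rule complete_tag, auto simp: step_simps push_def)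
next
  case (Neg \<phi>)
  from Neg.IH[OF _ Neg.prems(2)] Neg.prems(1)
  have "run N x (enc_formula \<phi> @ w) (canonical 1 0 n 0 0 0 (code (holds \<phi> x # ts)))" by simp
  then show ?case
    unfolding enc_formula.simps append_assoc
    by (rule complete_tag) (simp_all add: step_simps negate_codeI[OF canonical_simps(8) canonical_simps(8)] del: code.simps)
next
  case (Conj \<phi> \<psi>)
  from Conj.prems(1) have "is_formula n \<phi>" "is_formula n \<psi>" by simp_all
  note run = Conj.IH(1)[OF this(1) Conj.IH(2)[OF this(2) Conj.prems(2)]]
  show ?case
    unfolding enc_formula.simps append_assoc
    by (rule complete_tag[OF run])
      (simp_all add: step_simps combine_codeI[OF canonical_simps(8) canonical_simps(8)] del: code.simps)
next
  case (Disj \<phi> \<psi>)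
  from Disj.prems(1) have "is_formula n \<phi>" "is_formula n \<psi>" by simp_all
  note run = Disj.IH(1)[OF this(1) Disj.IH(2)[OF this(2) Disj.prems(2)]]
  show ?case
    unfolding enc_formula.simps append_assoc
    by (rule complete_tag[OF run])
      (simp_all add: step_simps combine_codeI[OF canonical_simps(8) canonical_simps(8)] del: code.simps)
qed

lemma complete_sentence:
  assumes "is_formula n \<phi>" "holds \<phi> x"
  shows "i + k = n \<Longrightarrow> run N x (enc_sentence k \<phi>) (canonical 0 i n 0 0 0 0)"
proof (induction k arbitrary: i)
  case 0
  have "run N x [] (canonical 1 0 n 0 0 0 (code []))"
    by (simp add: final_def)
  from complete_formula[OF assms(1) this] assms(2)
  have 1: "run N x (enc_formula \<phi>) (canonical 1 0 n 0 0 0 (code [True]))" by simp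
  have "step False (canonical 0 i n 0 0 0 0) (canonical 1 0 n 0 0 0 (code [True]))"
    using 0 by (simp add: step_simps)
  from run_canonicalI[OF 1 this] show ?case
    by (simp add: enc_sentence_def enc_unary_def)
next
  case (Suc k)
  have 1: "run N x (enc_sentence k \<phi>) (canonical 0 (Suc i) n 0 0 0 0)"
    using Suc by simp
  have "step True (canonical 0 i n 0 0 0 0) (canonical 0 (Suc i) n 0 0 0 0)"
    by (simp add: step_simps)
  from run_canonicalI[OF 1 this] show ?case
    by (simp add: enc_sentence_def enc_unary_def)
qed

lemma run_iff:
  assumes "length w \<le> N"
  shows "(\<exists>c. state c = 0 \<and> ctr c = 0 \<and> run N x w c) \<longleftrightarrow>
    (\<exists>n \<phi>. w = enc_sentence n \<phi> \<and> is_formula n \<phi> \<and> holds \<phi> x)"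
proof
  assume "\<exists>c. state c = 0 \<and> ctr c = 0 \<and> run N x w c"
  then obtain c where "run N x w c" "state c = 0" "ctr c = real 0" by auto
  from run_sentence[OF this assms] show "\<exists>n \<phi>. w = enc_sentence n \<phi> \<and> is_formula n \<phi> \<and> holds \<phi> x"
    by simp
next
  assume "\<exists>n \<phi>. w = enc_sentence n \<phi> \<and> is_formula n \<phi> \<and> holds \<phi> x"
  then obtain n \<phi> where 1: "w = enc_sentence n \<phi>" "is_formula n \<phi>" "holds \<phi> x"
    by (elim exE conjE)
  show "\<exists>c. state c = 0 \<and> ctr c = 0 \<and> run N x w c"
    using complete_sentence[OF 1(2,3), of 0 n] 1(1)
    by (intro exI[of _ "canonical 0 0 n 0 0 0 0"]) simp
qed

end

section \<open>The reduction\<close>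

text \<open>The first conjunct is the memory access: position \<open>idx c'\<close> keeps the value
  of one variable in \<open>stored\<close>, and a counter equal to that index must fetch it. Kind 2
  anchors the indices and the initial state, kinds 3 and 4 propagate the indices along the word
  together with the run.\<close>

definition pair_rel :: "real \<Rightarrow> conf \<Rightarrow> conf \<Rightarrow> bool" where
  "pair_rel \<kappa> c c' \<longleftrightarrow> (ctr c \<noteq> idx c' \<or> fetched c = stored c') \<and>
     (\<kappa> = 0 \<or> \<kappa> = 1 \<and> final c \<or>
      \<kappa> = 2 \<and> idx c = 0 \<and> idx c' = 1 \<and> state c' = 0 \<and> ctr c' = 0 \<or>
      \<kappa> = 3 \<and> idx c' = idx c + 1 \<and> step0 c c' \<or>
      \<kappa> = 4 \<and> idx c' = idx c + 1 \<and> step1 c c')"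

lemma run_imp_sequence:
  assumes "run N x w c"
  shows "\<exists>C. C 0 = c \<and> (\<forall>i\<le>length w. fetch_ok N x (C i)) \<and>
    (\<forall>i<length w. step (w ! i) (C i) (C (Suc i))) \<and> final (C (length w))"
  using assms
proof (induction w arbitrary: c)
  case Nil
  then show ?case by (intro exI[of _ "\<lambda>_. c"]) simp
next
  case (Cons b w)
  then obtain c' where f: "fetch_ok N x c" and c': "step b c c'" "run N x w c'" by auto
  from Cons.IH[OF c'(2)] obtain C where C: "C 0 = c'" "\<forall>i\<le>length w. fetch_ok N x (C i)"
    "\<forall>i<length w. step (w ! i) (C i) (C (Suc i))" "final (C (length w))" by (elim exE conjE)
  let ?C = "case_nat c C"
  have "fetch_ok N x (?C i)" if "i \<le> length (b # w)" for i
    using that f C(2) by (cases i) simp_all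
  moreover have "step ((b # w) ! i) (?C i) (?C (Suc i))" if "i < length (b # w)" for i
    using that c'(1) C(1,3) by (cases i) simp_all
  ultimately show ?case
    using C(4) by (intro exI[of _ ?C]) simp
qed

text \<open>The value of variable \<open>i\<close> is stored at position \<open>i\<close>, and the
  \<open>i\<close>-th configuration of the run stands at position \<open>i + 1\<close>. There are
  more positions than letters, so the variables of a sentence fit in.\<close>

lemma sequence_iff_run:
  "(\<exists>X. \<forall>p<framed_length w. \<forall>q<framed_length w. pair_rel (real (pair_kind w p q)) (X p) (X q)) \<longleftrightarrow>
   (\<exists>x c. state c = 0 \<and> ctr c = 0 \<and> run (framed_length w) x w c)"
proof
  let ?N = "framed_length w"
  assume "\<exists>X. \<forall>p<?N. \<forall>q<?N. pair_rel (real (pair_kind w p q)) (X p) (X q)"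
  then obtain X where X: "pair_rel (real (pair_kind w p q)) (X p) (X q)" if "p < ?N" "q < ?N" for p q
    by blast
  define x where "x i = stored (X i)" for i
  have start: "idx (X 0) = 0" "idx (X 1) = 1" "state (X 1) = 0" "ctr (X 1) = 0"
    using X[of 0 1] by (simp_all add: pair_rel_def pair_kind_def)
  have succ: "idx (X (Suc p)) = idx (X p) + 1" "step (w ! (p - 1)) (X p) (X (Suc p))"
    if "0 < p" "Suc p < ?N" for p
    using X[of p "Suc p"] that by (auto simp: pair_rel_def pair_kind_def step_def split: if_splits)
  have idx: "p < ?N \<Longrightarrow> idx (X p) = real p" for p
  proof (induction p)
    case (Suc p)
    then show ?case using start succ(1)[of p] by (cases p) simp_all
  qed (simp add: start)
  have fetch: "fetch_ok ?N x (X p)" if "p < ?N" for p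
    unfolding fetch_ok_def
  proof (intro allI impI)
    fix i assume "i < ?N" "ctr (X p) = real i"
    with X[OF that, of i] idx[of i] show "fetched (X p) = x i"
      by (simp add: pair_rel_def x_def)
  qed
  \<comment> \<open>The run is assembled from its end, by induction on the length \<open>k\<close>
    of the suffix still to be read.\<close>
  have "k \<le> length w \<Longrightarrow> run ?N x (drop (length w - k) w) (X (Suc (length w - k)))" for k
  proof (induction k)
    case 0
    have "final (X (Suc (length w)))"
      using X[of "Suc (length w)" "Suc (length w)"] by (simp add: pair_rel_def pair_kind_def)
    then show ?case
      using fetch[of "Suc (length w)"] by simp
  next
    case (Suc k)
    define j where "j = length w - Suc k"
    with Suc.prems have j: "length w - k = Suc j" "j < length w" by auto
    then have "run ?N x (drop (Suc j) w) (X (Suc (Suc j)))"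
      using Suc by simp
    moreover have "step (w ! j) (X (Suc j)) (X (Suc (Suc j)))"
      using succ(2)[of "Suc j"] j(2) by simp
    ultimately show ?case
      unfolding j_def[symmetric] Cons_nth_drop_Suc[OF j(2), symmetric]
      using fetch[of "Suc j"] j(2) by auto
  qed
  from this[of "length w"] start(3,4)
  show "\<exists>x c. state c = 0 \<and> ctr c = 0 \<and> run ?N x w c"
    by (intro exI[of _ x] exI[of _ "X 1"]) simp
next
  let ?N = "framed_length w"
  assume "\<exists>x c. state c = 0 \<and> ctr c = 0 \<and> run ?N x w c"
  then obtain x c where c: "state c = 0" "ctr c = 0" "run ?N x w c" by blast
  from run_imp_sequence[OF c(3)] obtain C where C: "C 0 = c" "\<forall>i\<le>length w. fetch_ok ?N x (C i)"
    "\<forall>i<length w. step (w ! i) (C i) (C (Suc i))" "final (C (length w))" by (elim exE conjE)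
  define place where "place c i = (c :: conf)\<lparr>idx := real i, stored := x i\<rparr>" for c i
  \<comment> \<open>Position 0 takes no part in the run, but the access condition binds it too;
    counter 0 with fetched value \<open>x 0\<close> satisfies it. \<open>place\<close> changes only
    registers that neither \<open>step\<close> nor \<open>final\<close> inspects.\<close>
  define X where "X i = place (case i of 0 \<Rightarrow> c\<lparr>ctr := 0, fetched := x 0\<rparr> | Suc j \<Rightarrow> C j) i" for i
  have place: "idx (place a i) = real i" "stored (place a i) = x i" "ctr (place a i) = ctr a"
    "fetched (place a i) = fetched a" "state (place a i) = state a" "final (place a i) = final a"
    "step b (place a i) (place a' i') = step b a a'" for a i a' i' b
    by (simp_all add: place_def final_def step_def step0_def step1_def goto_def push_def negate_def
        combine_def replace2_def)
  have fetch: "fetch_ok ?N x (X p)" if "p < ?N" for p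
    using C(2) that by (cases p) (auto simp: X_def fetch_ok_def place)
  have "pair_rel (real (pair_kind w p q)) (X p) (X q)" if pq: "p < ?N" "q < ?N" for p q
  proof -
    have idx: "idx (X i) = real i" "stored (X i) = x i" for i
      by (simp_all add: X_def place)
    have "ctr (X p) = idx (X q) \<Longrightarrow> fetched (X p) = stored (X q)"
      using fetch[OF pq(1)] pq(2) unfolding fetch_ok_def idx by blast
    moreover have "p = Suc (length w) \<Longrightarrow> final (X p)"
      using C(4) by (simp add: X_def place)
    moreover have "state (X 1) = 0" "ctr (X 1) = 0"
      using c C(1) by (simp_all add: X_def place)
    moreover have "step (w ! (p - 1)) (X p) (X (Suc p))" if "0 < p" "Suc p < ?N"
      using that C(3) by (cases p) (simp_all add: X_def place)
    ultimately show ?thesis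
      using pq by (auto simp: pair_rel_def pair_kind_def idx step_def split: if_splits)
  qed
  then show "\<exists>X. \<forall>p<?N. \<forall>q<?N. pair_rel (real (pair_kind w p q)) (X p) (X q)"
    by blast
qed

lemma ETR_iff_sequence:
  "w \<in> ETR \<longleftrightarrow> (\<exists>X. \<forall>p<framed_length w. \<forall>q<framed_length w. pair_rel (real (pair_kind w p q)) (X p) (X q))"
proof -
  have "w \<in> ETR \<longleftrightarrow> (\<exists>x n \<phi>. w = enc_sentence n \<phi> \<and> is_formula n \<phi> \<and> holds \<phi> x)"
    unfolding ETR_def by blast
  also have "\<dots> \<longleftrightarrow> (\<exists>x c. state c = 0 \<and> ctr c = 0 \<and> run (framed_length w) x w c)"
    by (subst run_iff) simp_all
  finally show ?thesis
    unfolding sequence_iff_run .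
qed

definition conf_at :: "(nat \<Rightarrow> real) \<Rightarrow> nat \<Rightarrow> conf" where
  "conf_at v r = \<lparr>idx = v r, stored = v (r + 1), state = v (r + 2), ctr = v (r + 3), fetched = v (r + 4),
     num = v (r + 5), coef = v (r + 6), mono = v (r + 7), acc = v (r + 8), stack = v (r + 9)\<rparr>"

text \<open>Unfolding leaves a positive Boolean combination of comparisons between integer
  polynomials. The 21 variables are the ten registers of each configuration and the kind.\<close>

lemma definable_pair_rel: "definable 21 (\<lambda>v. pair_rel (v 20) (conf_at v 0) (conf_at v 10))"
  unfolding pair_rel_def final_def step0_def step1_def goto_def push_def negate_def combine_def replace2_def
    Let_def conf_at_def conf.simps if_True if_False simp_thms
  by (intro definable_intros polyfun_intros) simp_all

text \<open>Of the variables of each pair, 0 and 1 are the coordinates of its circle, 2 is its kind, and the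
  variables from 3 on carry the registers (first ten) and the slack variables of \<open>F\<close> (from \<open>3 + 21\<close>).\<close>

definition slot :: "nat \<Rightarrow> nat \<Rightarrow> nat" where
  "slot K i = (if i < 10 then 3 + i else if i < 20 then K + 3 + (i - 10)
     else if i = 20 then 2 * K + 2 else 2 * K + 3 + i)"

definition defect :: "nat \<Rightarrow> ((nat \<Rightarrow> real) \<Rightarrow> real) \<Rightarrow> nat \<Rightarrow> (nat \<Rightarrow> real) \<Rightarrow> real" where
  "defect K f c y = (f (\<lambda>i. y (slot K i)))\<^sup>2 + ((y (2 * K))\<^sup>2 + (y (2 * K + 1))\<^sup>2 - 1)\<^sup>2 + (y (2 * K + 2) - real c)\<^sup>2"

lemma defect_nonneg: "0 \<le> defect K f c y"
  by (simp add: defect_def)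

lemma defect_eq_0_iff:
  "defect K f c y = 0 \<longleftrightarrow>
     f (\<lambda>i. y (slot K i)) = 0 \<and> (y (2 * K))\<^sup>2 + (y (2 * K + 1))\<^sup>2 = 1 \<and> y (2 * K + 2) = real c"
  by (auto simp: defect_def add_nonneg_eq_0_iff)

text \<open>With \<open>K = n + 3\<close> the last slack variable, of index \<open>n - 1\<close>,
  occupies the last of the \<open>3 * K\<close> places.\<close>

lemma ex_defect_poly:
  assumes "polyfun n f" "K = n + 3" "20 < n"
  shows "\<exists>P. is_poly (3 * K) P \<and> (\<forall>y. eval_poly P y = - defect K f c y)"
proof (rule polyfun_imp_int_poly)
  have "polyfun (3 * K) (\<lambda>y. f (\<lambda>i. y (slot K i)))"
    by (rule polyfun_rename[OF assms(1)]) (use assms(2,3) in \<open>auto simp: slot_def\<close>)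
  moreover have "polyfun (3 * K) (\<lambda>y. real c)"
    using polyfun.const[of "3 * K" "int c"] by simp
  ultimately show "polyfun (3 * K) (\<lambda>y. - defect K f c y)"
    unfolding defect_def using assms(2,3) by (intro polyfun_intros) simp_all
qed

lemma sum_sum_nonneg_eq_0_iff:
  fixes D :: "nat \<Rightarrow> nat \<Rightarrow> real"
  assumes "\<And>p q. 0 \<le> D p q"
  shows "(\<Sum>p<N. \<Sum>q<M. D p q) \<le> 0 \<longleftrightarrow> (\<forall>p<N. \<forall>q<M. D p q = 0)"
proof -
  have nonneg: "0 \<le> (\<Sum>p<N. \<Sum>q<M. D p q)"
    by (intro sum_nonneg assms)
  have "(\<Sum>p<N. \<Sum>q<M. D p q) = 0 \<longleftrightarrow> (\<forall>p<N. (\<Sum>q<M. D p q) = 0)"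
    by (subst sum_nonneg_eq_0_iff) (auto intro!: sum_nonneg assms)
  also have "\<dots> \<longleftrightarrow> (\<forall>p<N. \<forall>q<M. D p q = 0)"
    by (subst sum_nonneg_eq_0_iff) (auto intro!: assms)
  finally show ?thesis
    using nonneg by auto
qed

lemma cell_index_inject:
  fixes K :: nat
  assumes "k < K" "k' < K" "t < N" "t' < N" "(s * N + t) * K + k = (s' * N + t') * K + k'"
  shows "s = s' \<and> t = t' \<and> k = k'"
proof -
  have k: "k = k'"
    using arg_cong[OF assms(5), of "\<lambda>i. i mod K"] assms(1,2) by simp
  with assms(1,5) have st: "s * N + t = s' * N + t'" by simp
  have "t = t'"
    using arg_cong[OF st, of "\<lambda>i. i mod N"] assms(3,4) by simp
  with st assms(3) k show ?thesis by simp
qed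

context
  fixes n K :: nat and f :: "(nat \<Rightarrow> real) \<Rightarrow> real" and T :: "nat \<Rightarrow> int_poly"
  assumes n: "20 < n" and K: "K = n + 3" and f: "polyfun n f"
    and rel: "\<And>v. pair_rel (v 20) (conf_at v 0) (conf_at v 10) \<longleftrightarrow> (\<exists>v'. (\<forall>i<21. v' i = v i) \<and> f v' = 0)"
    and T: "\<And>c. is_poly (3 * K) (T c)" "\<And>c y. eval_poly (T c) y = - defect K f c y"
begin

lemma K_bounds: "23 < K" "i < n \<Longrightarrow> i + 3 < K"
  using n K by simp_all

lemma local_view_pair: "local_view K N x p q (2 * K + j) = cell K N x p q j"
  by (simp add: local_view_def)

definition feasible :: "bool list \<Rightarrow> (nat \<Rightarrow> real) \<Rightarrow> bool" where
  "feasible w x \<longleftrightarrow> (\<forall>p<framed_length w. \<forall>q<framed_length w.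
     f (\<lambda>i. local_view K (framed_length w) x p q (slot K i)) = 0 \<and>
     (cell K (framed_length w) x p q 0)\<^sup>2 + (cell K (framed_length w) x p q 1)\<^sup>2 = 1 \<and>
     cell K (framed_length w) x p q 2 = real (pair_kind w p q))"

lemma eval_generated_ge_1_iff: "eval_poly (generated K T w) x \<ge> 1 \<longleftrightarrow> feasible w x"
proof -
  let ?D = "\<lambda>p q. defect K f (pair_kind w p q) (local_view K (framed_length w) x p q)"
  have "eval_poly (generated K T w) x = 1 - (\<Sum>p<framed_length w. \<Sum>q<framed_length w. ?D p q)"
    unfolding eval_generated[OF T(1)] T(2) by (simp only: sum_negf add_uminus_conv_diff)
  then have "eval_poly (generated K T w) x \<ge> 1 \<longleftrightarrow> (\<Sum>p<framed_length w. \<Sum>q<framed_length w. ?D p q) \<le> 0"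
    by linarith
  also have "\<dots> \<longleftrightarrow> (\<forall>p<framed_length w. \<forall>q<framed_length w. ?D p q = 0)"
    by (rule sum_sum_nonneg_eq_0_iff) (rule defect_nonneg)
  finally show ?thesis
    using local_view_pair[where j = 0]
    by (simp only: feasible_def defect_eq_0_iff local_view_pair add_0_right)
qed

lemma view_slot:
  "local_view K N x p q (slot K i) =
     (if i < 10 then cell K N x p p (3 + i) else if i < 20 then cell K N x q q (3 + (i - 10))
      else if i = 20 then cell K N x p q 2 else cell K N x p q (3 + i))"
  using K_bounds(1) by (auto simp: local_view_def slot_def)

text \<open>Registers are read from the diagonal pairs \<open>(p, p)\<close>, so all constraints
  that involve a position see the same configuration.\<close>

lemma feasible_imp_ETR:
  assumes "feasible w x"
  shows "w \<in> ETR"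
proof -
  define N where "N = framed_length w"
  define X where "X p = conf_at (\<lambda>i. cell K N x p p (3 + i)) 0" for p
  have "pair_rel (real (pair_kind w p q)) (X p) (X q)" if "p < N" "q < N" for p q
  proof -
    let ?v = "\<lambda>i. local_view K N x p q (slot K i)"
    have "f ?v = 0" and kind: "cell K N x p q 2 = real (pair_kind w p q)"
      using assms that by (simp_all add: feasible_def N_def)
    then have "pair_rel (?v 20) (conf_at ?v 0) (conf_at ?v 10)"
      using rel[of ?v] by auto
    moreover have "?v 20 = real (pair_kind w p q)" "conf_at ?v 0 = X p" "conf_at ?v 10 = X q"
      by (simp_all add: view_slot kind X_def conf_at_def)
    ultimately show ?thesis by simp
  qed
  then show ?thesis
    unfolding ETR_iff_sequence N_def[symmetric] by blast
qed

text \<open>Variables 0 and 1 are the circle coordinates of the pair \<open>(0, 0)\<close>, and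
  \<open>slot\<close> never refers to the circle coordinates of a pair.\<close>

lemma feasible_rotate:
  assumes "feasible w x" "u\<^sup>2 + v\<^sup>2 = 1"
  shows "feasible w (x(0 := u, 1 := v))"
proof -
  define N where "N = framed_length w"
  define y where "y = x(0 := u, 1 := v)"
  have N: "0 < N" by (simp add: N_def)
  have low: "cell K N y s t k = (if s = 0 \<and> t = 0 \<and> k = 0 then u else if s = 0 \<and> t = 0 \<and> k = 1 then v
      else cell K N x s t k)" if "t < N" "k < K" for s t k
  proof -
    have "(s * N + t) * K + k = j \<longleftrightarrow> s = 0 \<and> t = 0 \<and> k = j" if "j < K" for j
      using cell_index_inject[of k K j t N 0 s 0] \<open>t < N\<close> \<open>k < K\<close> that by auto
    from this[of 0] this[of 1] show ?thesis
      using K_bounds(1) by (auto simp: cell_def y_def)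
  qed
  have "f (\<lambda>i. local_view K N y p q (slot K i)) = f (\<lambda>i. local_view K N x p q (slot K i))"
    if "p < N" "q < N" for p q
  proof (rule polyfun_cong[OF f])
    fix i assume "i < n"
    from K_bounds(2)[OF this] show "local_view K N y p q (slot K i) = local_view K N x p q (slot K i)"
      using that K_bounds(1) by (auto simp: view_slot low)
  qed
  with assms show ?thesis
    unfolding feasible_def N_def[symmetric] y_def[symmetric]
    using K_bounds(1) by (auto simp: low)
qed

lemma feasible_circle:
  assumes "feasible w x"
  shows "(x 0)\<^sup>2 + (x 1)\<^sup>2 = 1"
proof -
  have "(cell K (framed_length w) x 0 0 0)\<^sup>2 + (cell K (framed_length w) x 0 0 1)\<^sup>2 = 1"
    using assms unfolding feasible_def by (metis add_gr_0 zero_less_numeral)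
  then show ?thesis
    by (simp add: cell_def)
qed

lemma ETR_imp_feasible:
  assumes "w \<in> ETR"
  shows "\<exists>x. feasible w x \<and> (\<forall>i\<ge>framed_length w * (framed_length w * K). x i = 0)"
proof -
  define N where "N = framed_length w"
  from assms obtain X where X: "\<forall>p<N. \<forall>q<N. pair_rel (real (pair_kind w p q)) (X p) (X q)"
    unfolding ETR_iff_sequence N_def[symmetric] by (elim exE)
  define reg where "reg c = (\<lambda>i. [idx c, stored c, state c, ctr c, fetched c, num c, coef c, mono c, acc c, stack c] ! i)"
    for c :: conf
  define base where "base p q i = (if i < 10 then reg (X p) i else if i < 20 then reg (X q) (i - 10)
     else real (pair_kind w p q))" for p q i
  have "\<exists>v'. (\<forall>i<21. v' i = base p q i) \<and> f v' = 0" if "p < N" "q < N" for p q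
  proof -
    have "conf_at (base p q) 0 = X p" "conf_at (base p q) 10 = X q" "base p q 20 = real (pair_kind w p q)"
      by (simp_all add: base_def conf_at_def reg_def)
    then show ?thesis
      using X that rel[of "base p q"] by simp
  qed
  then obtain V where V: "\<And>p q i. p < N \<Longrightarrow> q < N \<Longrightarrow> i < 21 \<Longrightarrow> V p q i = base p q i"
    "\<And>p q. p < N \<Longrightarrow> q < N \<Longrightarrow> f (V p q) = 0" by metis
  \<comment> \<open>Each circle gets the point \<open>(1, 0)\<close>. Registers are copied from
    \<open>X s\<close>, which matters on the diagonal, and slack variable \<open>i\<close> of the
    pair is found at place \<open>i + 3\<close>.\<close>
  define Z where "Z s t k = (if k = 0 then 1 else if k = 1 then 0 else if k = 2 then real (pair_kind w s t)
     else if k < 13 then reg (X s) (k - 3) else V s t (k - 3))" for s t k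
  define x where "x i = (if i < N * (N * K) then Z (i div K div N) (i div K mod N) (i mod K) else 0)" for i
  have cell: "cell K N x s t k = Z s t k" if "s < N" "t < N" "k < K" for s t k
  proof -
    have "s * N + t < N * N"
    proof -
      have "s * N + t < s * N + N" using that(2) by simp
      also have "\<dots> = Suc s * N" by simp
      also have "\<dots> \<le> N * N" using that(1) by (intro mult_le_mono1) simp
      finally show ?thesis .
    qed
    then have "Suc (s * N + t) * K \<le> N * N * K"
      by (intro mult_le_mono1) simp
    moreover have "(s * N + t) * K + k < Suc (s * N + t) * K"
      using that(3) by simp
    ultimately have "(s * N + t) * K + k < N * (N * K)"
      by (simp only: mult.assoc less_le_trans)
    moreover have "((s * N + t) * K + k) div K = s * N + t" "((s * N + t) * K + k) mod K = k"
      using that(3) by simp_all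
    moreover have "(s * N + t) div N = s" "(s * N + t) mod N = t"
      using that(2) by simp_all
    ultimately show ?thesis
      unfolding cell_def x_def by (simp only: if_True)
  qed
  have "feasible w x"
    unfolding feasible_def N_def[symmetric]
  proof (intro allI impI conjI)
    fix p q
    assume pq: "p < N" "q < N"
    have "f (\<lambda>i. local_view K N x p q (slot K i)) = f (V p q)"
    proof (rule polyfun_cong[OF f])
      fix i assume "i < n"
      from K_bounds(2)[OF this] show "local_view K N x p q (slot K i) = V p q i"
        using pq K_bounds(1) V(1)[OF pq, of i] by (auto simp: view_slot cell Z_def base_def)
    qed
    with V(2)[OF pq] show "f (\<lambda>i. local_view K N x p q (slot K i)) = 0" by simp
    show "(cell K N x p q 0)\<^sup>2 + (cell K N x p q 1)\<^sup>2 = 1"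
      "cell K N x p q 2 = real (pair_kind w p q)"
      using pq K_bounds(1) by (simp_all add: cell Z_def)
  qed
  moreover have "\<forall>i\<ge>N * (N * K). x i = 0"
    by (simp add: x_def)
  ultimately show ?thesis
    unfolding N_def by blast
qed

lemma ETR_iff_has_hole: "w \<in> ETR \<longleftrightarrow> has_hole (framed_length w * (framed_length w * K)) (generated K T w) 1"
proof
  let ?d = "framed_length w * (framed_length w * K)"
  assume "w \<in> ETR"
  from ETR_imp_feasible[OF this] obtain z where z: "feasible w z" "\<forall>i\<ge>?d. z i = 0"
    by (elim exE conjE)
  show "has_hole ?d (generated K T w) 1"
  proof (rule has_hole_if_circle_factor)
    show "2 \<le> ?d"
      using K_bounds(1) by simp
    show "(x 0)\<^sup>2 + (x 1)\<^sup>2 = 1" if "1 \<le> eval_poly (generated K T w) x" for x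
      using that unfolding eval_generated_ge_1_iff by (rule feasible_circle)
    show "1 \<le> eval_poly (generated K T w) (z(0 := u, 1 := v))" if "u\<^sup>2 + v\<^sup>2 = 1" for u v
      unfolding eval_generated_ge_1_iff by (rule feasible_rotate[OF z(1) that])
    show "z i = 0" if "?d \<le> i" for i
      using z(2) that by blast
  qed
next
  let ?d = "framed_length w * (framed_length w * K)"
  assume hole: "has_hole ?d (generated K T w) 1"
  show "w \<in> ETR"
  proof (rule ccontr)
    assume "w \<notin> ETR"
    then have "\<not> 1 \<le> eval_poly (generated K T w) x" for x
      unfolding eval_generated_ge_1_iff using feasible_imp_ETR by blast
    then have "eval_poly (generated K T w) x < 1" for x
      by (simp add: not_le)
    with no_hole_if_empty[of "generated K T w" 1 ?d] hole show False by blast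
  qed
qed

end

theorem theorem5p3:
  shows "ER_hard HD"
proof -
  from definable_pair_rel obtain n f where n: "21 \<le> n" and f: "polyfun n f"
    and rel: "\<forall>v. pair_rel (v 20) (conf_at v 0) (conf_at v 10) \<longleftrightarrow> (\<exists>v'. (\<forall>i<21. v' i = v i) \<and> f v' = 0)"
    unfolding definable_def by (elim exE conjE)
  have n': "20 < n" using n by simp
  define K where "K = n + 3"
  have "\<forall>c. \<exists>P. is_poly (3 * K) P \<and> (\<forall>y. eval_poly P y = - defect K f c y)"
    using ex_defect_poly[OF f K_def n'] by blast
  \<comment> \<open>The polynomials are fixed before any word is given and only \<open>T 0\<close>
    to \<open>T 4\<close> are built into the machine, so their mere existence suffices.\<close>
  then obtain T where T: "\<And>c. is_poly (3 * K) (T c)" "\<And>c y. eval_poly (T c) y = - defect K f c y"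
    by metis
  let ?g = "\<lambda>w. enc_HD_instance (framed_length w * (framed_length w * K)) (generated K T w) 1 1"
  have "w \<in> ETR \<longleftrightarrow> ?g w \<in> HD" for w
    unfolding enc_HD_instance_in_HD_iff
    using ETR_iff_has_hole[OF n' K_def f rel[rule_format] T, of w] is_poly_generated[of w K T] by simp
  moreover have "polytime_computable ?g"
    by (rule polytime_computable_generated)
  ultimately show ?thesis
    unfolding ER_hard_def polytime_reducible_def by blast
qed

end
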